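(* Let $s\ge 1$ and $k\ge1$ be integers and $n\ge 12ks\log(e^2s)$. If $\mathcal F_1,\dots,\mathcal F_s\subset\binom{[n]}{k}$ are cross-dependent, then $$\min_{i\in[s]}|\mathcal F_i|\le\binom{n}{k}-\binom{n-s+1}{k}.$$
   Context: $\log$ is the natural logarithm. $\binom{[n]}{k}$ is the family of $k$-subsets of $[n]=\{1,\dots,n\}$. Families $\mathcal F_1,\dots,\mathcal F_s$ are cross-dependent if there is no choice of $F_1\in\mathcal F_1,\dots,F_s\in\mathcal F_s$ with the $F_i$ pairwise disjoint. *)

theory Defs
  imports Complex_Main "HOL-Library.Ramsey" "HOL-Library.Disjoint_Sets"
begin

text \<open>Disjointness is required for distinct indices, so choosing the same nonempty set
  from two of the families does not count as a disjoint choice.\<close>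

definition cross_dependent :: "'i set \<Rightarrow> ('i \<Rightarrow> 'a set set) \<Rightarrow> bool" where
  "cross_dependent I \<F> \<longleftrightarrow>
     \<not> (\<exists>F. (\<forall>i\<in>I. F i \<in> \<F> i) \<and> disjoint_family_on F I)"

end

(* By simultaneous shifting the families may be assumed shifted. Suppose all of them are larger than the
   family of k-sets meeting {1..s-1}. Give each family F_i a distinct element j of {1..s} and look for
   pairwise disjoint (k-1)-sets A_i in {s+1..n} with A_i + {j} in F_i. These are found in a random
   collection of disjoint (k-1)-sets: for shifted families the events that given blocks lie in given
   families are negatively correlated, so the number of blocks in a link has Chernoff-type tails, and
   a family given j = s + 1 - r only needs r hits, as one can choose greedily. That the links are dense
   enough follows from the size of F_i and from Katona's shadow bound, which applies unless F_i contains
   the progression {s + c, s + 2c, ..., s + kc} with c = 6s; in that case F_i contains every k-set that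
   lies below the progression, and such sets can be found in a reserved random part of the ground set. *)
theory Submission
  imports Defs "HOL-Analysis.Harmonic_Numbers"
begin

section \<open>Negative association of disjoint random blocks\<close>

text \<open>The obstacle is the link at \<open>s\<close>. For a family without the progression it is
  only known to be nonempty, whereas the link at \<open>j < s\<close> has density at least
  \<open>(s - j) / (s - j + c)\<close>. If some family contains the progression, the others can do
  without \<open>s\<close>. Otherwise \<open>s\<close> goes to the family whose link there is
  densest, and the parameter \<open>z\<close> of the exponential moment is adapted to that density.
  The value c = 6s is a compromise: a smaller c makes the links denser, a larger c makes the
  progression so sparse that about half of the ground set still holds s disjoint sets below it. The
  failure bound for a family given \<open>j\<close> decays geometrically in \<open>s - j\<close>.
  These numbers are distinct, so the bounds sum to a constant independent of s, and a number of
  blocks linear in s is enough. The hypothesis on n enters as n >= 32sk, which leaves room for 31s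
  blocks of size k - 1 beyond s.\<close>

definition avg :: "nat \<Rightarrow> nat \<Rightarrow> nat \<Rightarrow> (nat set \<Rightarrow> real) \<Rightarrow> real" where
  "avg a N m g = (\<Sum>A\<in>nsets {a<..a+N} m. g A) / real (N choose m)"

text \<open>The direction suits the test functions \<open>if A \<in> F then z else 1\<close> with
  \<open>z \<le> 1\<close>: for a shifted \<open>F\<close> a downward shift can turn a miss into a
  hit but not a hit into a miss.\<close>

definition shift_incr :: "nat set \<Rightarrow> (nat set \<Rightarrow> real) \<Rightarrow> bool" where
  "shift_incr V g \<longleftrightarrow>
     (\<forall>A x y. A \<subseteq> V \<longrightarrow> x \<in> A \<longrightarrow> y \<in> V - A \<longrightarrow> y < x \<longrightarrow> g (insert y (A - {x})) \<le> g A)"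

definition shifted :: "nat set \<Rightarrow> nat set set \<Rightarrow> bool" where
  "shifted V F \<longleftrightarrow> (\<forall>A\<in>F. \<forall>x\<in>A. \<forall>y\<in>V - A. y < x \<longrightarrow> insert y (A - {x}) \<in> F)"

lemma shift_incrD:
  "shift_incr V g \<Longrightarrow> A \<subseteq> V \<Longrightarrow> x \<in> A \<Longrightarrow> y \<in> V - A \<Longrightarrow> y < x \<Longrightarrow> g (insert y (A - {x})) \<le> g A"
  unfolding shift_incr_def by blast

lemma sum_nsets_insert:
  fixes g :: "'a set \<Rightarrow> real"
  assumes "finite V" "v \<notin> V"
  shows "(\<Sum>A\<in>nsets (insert v V) (Suc m). g A)
       = (\<Sum>A\<in>nsets V m. g (insert v A)) + (\<Sum>A\<in>nsets V (Suc m). g A)"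
proof -
  have eq: "nsets (insert v V) (Suc m) = insert v ` nsets V m \<union> nsets V (Suc m)"
  proof (intro equalityI subsetI)
    fix A assume A: "A \<in> nsets (insert v V) (Suc m)"
    show "A \<in> insert v ` nsets V m \<union> nsets V (Suc m)"
    proof (cases "v \<in> A")
      case True
      then have "A - {v} \<in> nsets V m" "A = insert v (A - {v})"
        using A by (auto simp: nsets_def card_Diff_singleton)
      then show ?thesis by blast
    next
      case False
      then show ?thesis using A by (auto simp: nsets_def)
    qed
  next
    fix A assume "A \<in> insert v ` nsets V m \<union> nsets V (Suc m)"
    then show "A \<in> nsets (insert v V) (Suc m)"
      using assms by (auto simp: nsets_def card_insert_if)
  qed
  have inj: "inj_on (insert v) (nsets V m)"
  proof (rule inj_onI)
    fix A B assume "A \<in> nsets V m" "B \<in> nsets V m" "insert v A = insert v B"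
    moreover from this have "v \<notin> A" "v \<notin> B" using assms by (auto simp: nsets_def)
    ultimately show "A = B" by (simp add: insert_ident)
  qed
  have "insert v ` nsets V m \<inter> nsets V (Suc m) = {}"
    using assms by (auto simp: nsets_def)
  then show ?thesis unfolding eq
    using assms inj by (subst sum.union_disjoint) (auto simp: finite_imp_finite_nsets sum.reindex)
qed

text \<open>Condition on whether the top element lies in the random \<open>m\<close>-set, which has
  probability \<open>m / Suc N\<close>. For \<open>m = 0\<close> and \<open>m = Suc N\<close> the
  case that cannot occur has weight 0.\<close>

lemma avg_Suc:
  assumes "m \<le> Suc N"
  shows "avg a (Suc N) m g
    = (real m / real (Suc N)) * avg a N (m - 1) (\<lambda>A. g (insert (a + Suc N) A))
      + (1 - real m / real (Suc N)) * avg a N m g"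
proof (cases m)
  case 0
  then show ?thesis by (simp add: avg_def nsets_zero)
next
  case (Suc l)
  define S1 where "S1 = (\<Sum>A\<in>nsets {a<..a+N} l. g (insert (a + Suc N) A))"
  define S2 where "S2 = (\<Sum>A\<in>nsets {a<..a+N} (Suc l). g A)"
  have V: "{a<..a + Suc N} = insert (a + Suc N) {a<..a+N}" by auto
  have S: "(\<Sum>A\<in>nsets {a<..a+Suc N} (Suc l). g A) = S1 + S2"
    unfolding V S1_def S2_def by (rule sum_nsets_insert) auto
  have l: "l \<le> N" using assms Suc by simp
  define C where "C = real (Suc N choose Suc l)"
  have C: "C > 0" unfolding C_def using l by (simp add: zero_less_binomial_iff del: binomial_Suc_Suc)
  have "real (Suc l) * C = real (Suc N) * real (N choose l)"
    unfolding C_def by (metis Suc_times_binomial of_nat_mult)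
  then have c1: "real (N choose l) = real (Suc l) / real (Suc N) * C"
    by (simp add: field_simps)
  have "(Suc N - Suc l) * (Suc N choose Suc l) = Suc N * (N choose Suc l)"
    using binomial_absorb_comp[of "Suc N" "Suc l"] by simp
  then have "real (Suc N - Suc l) * C = real (Suc N) * real (N choose Suc l)"
    unfolding C_def by (metis of_nat_mult)
  then have c2: "real (N choose Suc l) = (1 - real (Suc l) / real (Suc N)) * C"
    using l by (simp add: field_simps of_nat_diff)
  have t1: "(real (Suc l) / real (Suc N)) * (S1 / real (N choose l)) = S1 / C"
    unfolding c1 using C by (simp del: of_nat_Suc)
  have t2: "(1 - real (Suc l) / real (Suc N)) * (S2 / real (N choose Suc l)) = S2 / C"
  proof (cases "l = N")
    case True
    then have "S2 = 0" unfolding S2_def by (simp add: nsets_eq_empty)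
    then show ?thesis by simp
  next
    case False
    then have "1 - real (Suc l) / real (Suc N) \<noteq> 0" using l by (simp add: field_simps)
    then show ?thesis unfolding c2 using C by (simp del: of_nat_Suc)
  qed
  show ?thesis
    unfolding Suc avg_def S diff_Suc_1 S1_def[symmetric] S2_def[symmetric] C_def[symmetric] t1 t2
    by (simp add: add_divide_distrib)
qed

text \<open>Double counting of pairs \<open>b \<in> B\<close>: exchanging \<open>b\<close> for the
  top element does not decrease \<open>g\<close>, and each \<open>m\<close>-set arises as
  \<open>B - {b}\<close> from \<open>N - m\<close> pairs.\<close>

lemma avg_insert_top_ge:
  assumes "m < N" and g: "shift_incr {a<..a + Suc N} g"
  shows "avg a N (Suc m) g \<le> avg a N m (\<lambda>A. g (insert (a + Suc N) A))"
proof -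
  let ?V = "{a<..a+N}" and ?v = "a + Suc N"
  have "real (Suc m) * (\<Sum>B\<in>nsets ?V (Suc m). g B) = (\<Sum>B\<in>nsets ?V (Suc m). \<Sum>b\<in>B. g B)"
    by (simp add: sum_distrib_left nsets_def)
  also have "\<dots> \<le> (\<Sum>B\<in>nsets ?V (Suc m). \<Sum>b\<in>B. g (insert ?v (B - {b})))"
  proof (intro sum_mono)
    fix B b assume B: "B \<in> nsets ?V (Suc m)" "b \<in> B"
    have "g (insert b (insert ?v (B - {b}) - {?v})) \<le> g (insert ?v (B - {b}))"
      by (rule shift_incrD[OF g]) (use B in \<open>auto simp: nsets_def subset_iff\<close>)
    moreover have "insert b (insert ?v (B - {b}) - {?v}) = B"
      using B by (auto simp: nsets_def)
    ultimately show "g B \<le> g (insert ?v (B - {b}))" by simp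
  qed
  also have "\<dots> = (\<Sum>(B,b)\<in>Sigma (nsets ?V (Suc m)) (\<lambda>B. B). g (insert ?v (B - {b})))"
    by (rule sum.Sigma) (auto simp: finite_imp_finite_nsets nsets_def)
  also have "\<dots> = (\<Sum>(A,b)\<in>Sigma (nsets ?V m) (\<lambda>A. ?V - A). g (insert ?v A))"
    by (rule sum.reindex_bij_witness[where i = "\<lambda>(A,b). (insert b A, b)" and j = "\<lambda>(B,b). (B - {b}, b)"])
       (auto simp: nsets_def card_insert_if card_Diff_singleton insert_absorb)
  also have "\<dots> = (\<Sum>A\<in>nsets ?V m. \<Sum>b\<in>?V - A. g (insert ?v A))"
    by (rule sum.Sigma[symmetric]) (auto simp: finite_imp_finite_nsets nsets_def)
  also have "\<dots> = (\<Sum>A\<in>nsets ?V m. real (N - m) * g (insert ?v A))"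
    by (intro sum.cong refl) (auto simp: nsets_def card_Diff_subset)
  also have "\<dots> = real (N - m) * (\<Sum>A\<in>nsets ?V m. g (insert ?v A))"
    by (simp add: sum_distrib_left)
  finally have le: "real (Suc m) * (\<Sum>B\<in>nsets ?V (Suc m). g B)
      \<le> real (N - m) * (\<Sum>A\<in>nsets ?V m. g (insert ?v A))" .
  have "Suc m * (N choose Suc m) = (N - m) * (N choose m)"
    by (metis binomial_absorption binomial_absorb_comp mult.commute)
  then have bin: "real (Suc m) * real (N choose Suc m) = real (N - m) * real (N choose m)"
    by (metis of_nat_mult)
  have pos: "real (N choose Suc m) > 0" "real (N choose m) > 0" "real (N - m) > 0"
    using assms(1) by (auto simp: zero_less_binomial_iff)
  have "avg a N (Suc m) g = (real (Suc m) * (\<Sum>B\<in>nsets ?V (Suc m). g B)) / (real (Suc m) * real (N choose Suc m))"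
    unfolding avg_def by simp
  also have "\<dots> \<le> (real (N - m) * (\<Sum>A\<in>nsets ?V m. g (insert ?v A))) / (real (N - m) * real (N choose m))"
    unfolding bin using le pos by (intro divide_right_mono) auto
  also have "\<dots> = avg a N m (\<lambda>A. g (insert ?v A))"
    unfolding avg_def using pos by simp
  finally show ?thesis .
qed

lemma avg_nonneg: "(\<And>A. g A \<ge> 0) \<Longrightarrow> avg a N m g \<ge> 0"
  unfolding avg_def by (intro divide_nonneg_nonneg sum_nonneg) auto

text \<open>The left side collects the terms of order at most one in \<open>w\<close> of the
  expanded product; the remaining terms are nonnegative.\<close>

lemma prod_add_ge:
  fixes u w :: "'t \<Rightarrow> real"
  assumes "finite I" "\<And>t. t \<in> I \<Longrightarrow> u t \<ge> 0" "\<And>t. t \<in> I \<Longrightarrow> w t \<ge> 0"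
  shows "(\<Prod>t\<in>I. u t) + (\<Sum>i\<in>I. w i * (\<Prod>t\<in>I - {i}. u t)) \<le> (\<Prod>t\<in>I. u t + w t)"
  using assms
proof (induction I rule: finite_induct)
  case empty
  then show ?case by simp
next
  case (insert x I)
  let ?P = "\<Prod>t\<in>I. u t" and ?S = "\<Sum>i\<in>I. w i * (\<Prod>t\<in>I - {i}. u t)"
  have IH: "?P + ?S \<le> (\<Prod>t\<in>I. u t + w t)" using insert by simp
  have S0: "?S \<ge> 0" using insert by (intro sum_nonneg mult_nonneg_nonneg prod_nonneg) auto
  have "(\<Prod>t\<in>insert x I - {i}. u t) = u x * (\<Prod>t\<in>I - {i}. u t)" if "i \<in> I" for i
  proof -
    have "insert x I - {i} = insert x (I - {i})" using insert that by auto
    then show ?thesis using insert by simp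
  qed
  then have e: "(\<Sum>i\<in>I. w i * (\<Prod>t\<in>insert x I - {i}. u t)) = u x * ?S"
    by (simp add: sum_distrib_left mult.left_commute)
  have "insert x I - {x} = I" using insert by auto
  then have "(\<Prod>t\<in>insert x I. u t) + (\<Sum>i\<in>insert x I. w i * (\<Prod>t\<in>insert x I - {i}. u t))
     = u x * ?P + (w x * ?P + u x * ?S)"
    using insert e by simp
  also have "\<dots> \<le> (u x + w x) * (?P + ?S)"
    using insert S0 by (simp add: algebra_simps)
  also have "\<dots> \<le> (u x + w x) * (\<Prod>t\<in>I. u t + w t)"
    using insert IH by (intro mult_left_mono) auto
  finally show ?case using insert by simp
qed

text \<open>Positivity of \<open>p i\<close> is recorded because it certifies that the selected
  outcome is possible, that is, that the block sizes still fit after it.\<close>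

lemma exists_le_weighted_average:
  fixes p \<Phi> :: "'t \<Rightarrow> real"
  assumes "finite I" "\<And>i. i \<in> I \<Longrightarrow> p i \<ge> 0" "(\<Sum>i\<in>I. p i) = 1" "(\<Sum>i\<in>I. p i * \<Phi> i) \<le> b"
  shows "\<exists>i\<in>I. p i > 0 \<and> \<Phi> i \<le> b"
proof (rule ccontr)
  assume neg: "\<not> ?thesis"
  have ge: "p i * b \<le> p i * \<Phi> i" if "i \<in> I" for i
    using neg that assms(2)[OF that] by (cases "p i = 0") (auto intro!: mult_left_mono)
  obtain i where i: "i \<in> I" "p i > 0"
    using assms(2,3) by (metis less_eq_real_def sum.neutral zero_neq_one)
  have "(\<Sum>i\<in>I. p i * b) < (\<Sum>i\<in>I. p i * \<Phi> i)"
    using assms(1) ge i neg by (intro sum_strict_mono_ex1) (auto intro!: bexI[of _ i])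
  then show False using assms(3,4) by (simp add: sum_distrib_right[symmetric])
qed

lemma shift_incr_subset: "shift_incr V g \<Longrightarrow> W \<subseteq> V \<Longrightarrow> shift_incr W g"
  unfolding shift_incr_def by (meson Diff_mono order_refl subsetD subset_trans)

lemma shift_incr_insert_top:
  assumes g: "shift_incr V g" and "W \<subseteq> V" "v \<in> V" "\<And>w. w \<in> W \<Longrightarrow> w < v"
  shows "shift_incr W (\<lambda>A. g (insert v A))"
  unfolding shift_incr_def
proof (intro allI impI)
  fix A x y assume A: "A \<subseteq> W" "x \<in> A" "y \<in> W - A" "y < x"
  have "x < v" "y < v" using A assms(4) by blast+
  moreover from this have "insert v (insert y (A - {x})) = insert y (insert v A - {x})" by auto
  moreover have "g (insert y (insert v A - {x})) \<le> g (insert v A)"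
    using A assms \<open>y < v\<close> by (intro shift_incrD[OF g]) auto
  ultimately show "g (insert v (insert y (A - {x}))) \<le> g (insert v A)" by simp
qed

text \<open>This is negative association of the blocks of a random partial partition, in derandomised
  form: the largest element of the ground set is assigned to block \<open>t\<close> with probability
  \<open>sz t / N\<close>, and the monotonicity of the test functions makes the expected product drop.\<close>

lemma exists_disjoint_blocks:
  fixes g :: "'e \<Rightarrow> 't \<Rightarrow> nat set \<Rightarrow> real" and sz :: "'t \<Rightarrow> nat"
  assumes "finite I" and "(\<Sum>t\<in>I. sz t) \<le> N"
    and "\<And>e. e \<in> E \<Longrightarrow> w e \<ge> 0"
    and "\<And>e t A. e \<in> E \<Longrightarrow> t \<in> I \<Longrightarrow> g e t A \<ge> 0"
    and "\<And>e t. e \<in> E \<Longrightarrow> t \<in> I \<Longrightarrow> shift_incr {a<..a+N} (g e t)"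
  shows "\<exists>A. (\<forall>t\<in>I. A t \<in> nsets {a<..a+N} (sz t)) \<and> disjoint_family_on A I \<and>
    (\<Sum>e\<in>E. w e * (\<Prod>t\<in>I. g e t (A t))) \<le> (\<Sum>e\<in>E. w e * (\<Prod>t\<in>I. avg a N (sz t) (g e t)))"
  using assms
proof (induction N arbitrary: sz g)
  case 0
  then have "\<forall>t\<in>I. sz t = 0" by simp
  then show ?case
    by (intro exI[of _ "\<lambda>t. {}"]) (auto simp: disjoint_family_on_def avg_def)
next
  case (Suc N)
  define v where "v = a + Suc N"
  define u0 where "u0 e t = avg a N (sz t) (g e t)" for e t
  define u1 where "u1 e t = avg a N (sz t - 1) (\<lambda>A. g e t (insert v A))" for e t
  define q where "q t = real (sz t) / real (Suc N)" for t
  have sub: "{a<..a+N} \<subseteq> {a<..a+Suc N}" and vin: "v \<in> {a<..a + Suc N}" by (auto simp: v_def)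
  have szle: "sz t \<le> Suc N" if "t \<in> I" for t
    using Suc.prems(1,2) that member_le_sum[of t I sz] by simp
  have q0: "q t \<ge> 0" for t unfolding q_def by simp
  have qsum: "(\<Sum>t\<in>I. q t) \<le> 1"
    unfolding q_def sum_divide_distrib[symmetric] of_nat_sum[symmetric]
    using Suc.prems(2) by (simp del: of_nat_sum of_nat_Suc)
  have u0: "u0 e t \<ge> 0" if "e \<in> E" "t \<in> I" for e t
    unfolding u0_def using Suc.prems(4) that by (intro avg_nonneg) auto
  have u1: "u1 e t \<ge> 0" if "e \<in> E" "t \<in> I" for e t
    unfolding u1_def using Suc.prems(4) that by (intro avg_nonneg) auto
  have mono: "q t * (u1 e t - u0 e t) \<ge> 0" if et: "e \<in> E" "t \<in> I" for e t
  proof -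
    consider "sz t = 0" | "sz t = Suc N" | m where "sz t = Suc m" "m < N"
      using szle[OF et(2)] by (cases "sz t") fastforce+
    then show ?thesis
    proof cases
      case 1 then show ?thesis by (simp add: q_def)
    next
      \<comment> \<open>No set of size \<open>Suc N\<close> avoids \<open>v\<close>, so
        \<open>u0\<close> is an empty sum and \<open>u1 \<ge> 0\<close> is enough.\<close>
      case 2
      then have "u0 e t = 0" unfolding u0_def avg_def by simp
      then show ?thesis using u1[OF et] q0 by simp
    next
      case 3
      then have "u0 e t \<le> u1 e t" unfolding u0_def u1_def v_def
        using avg_insert_top_ge[OF 3(2) Suc.prems(5)[OF et]] by simp
      then show ?thesis using q0 by simp
    qed
  qed
  have rec: "avg a (Suc N) (sz t) (g e t) = u0 e t + q t * (u1 e t - u0 e t)" if "t \<in> I" for e t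
    unfolding avg_Suc[OF szle[OF that]] u0_def u1_def q_def v_def by (simp add: algebra_simps)
  \<comment> \<open>\<open>None\<close> stands for leaving \<open>v\<close> out of every block,
    \<open>Some i\<close> for putting it into block \<open>i\<close>; \<open>\<Phi>\<close> is the
    bound that the induction hypothesis gives after that choice.\<close>
  define p where "p o' = (case o' of None \<Rightarrow> 1 - (\<Sum>t\<in>I. q t) | Some i \<Rightarrow> q i)" for o'
  define \<Phi> where "\<Phi> o' = (case o' of None \<Rightarrow> (\<Sum>e\<in>E. w e * (\<Prod>t\<in>I. u0 e t))
      | Some i \<Rightarrow> (\<Sum>e\<in>E. w e * (u1 e i * (\<Prod>t\<in>I - {i}. u0 e t))))" for o'
  let ?b = "\<Sum>e\<in>E. w e * (\<Prod>t\<in>I. avg a (Suc N) (sz t) (g e t))"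
  let ?O = "insert None (Some ` I)"
  have sumO: "(\<Sum>o'\<in>?O. f o') = f None + (\<Sum>i\<in>I. f (Some i))" for f :: "'t option \<Rightarrow> real"
    using Suc.prems(1) by (subst sum.insert) (auto simp: sum.reindex)
  have "(\<Sum>o'\<in>?O. p o' * \<Phi> o') \<le> ?b"
  proof -
    have "(\<Sum>o'\<in>?O. p o' * \<Phi> o') = (\<Sum>e\<in>E. w e * ((1 - (\<Sum>t\<in>I. q t)) * (\<Prod>t\<in>I. u0 e t)
        + (\<Sum>i\<in>I. q i * (u1 e i * (\<Prod>t\<in>I - {i}. u0 e t)))))"
      unfolding sumO p_def \<Phi>_def option.case
      by (simp add: sum_distrib_left sum.distrib distrib_left mult.left_commute sum.swap[of _ I E])
    also have "\<dots> \<le> ?b"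
    proof (intro sum_mono mult_left_mono)
      fix e assume e: "e \<in> E"
      have P: "(\<Prod>t\<in>I. u0 e t) = u0 e i * (\<Prod>t\<in>I - {i}. u0 e t)" if "i \<in> I" for i
        using Suc.prems(1) that by (rule prod.remove)
      have "(1 - (\<Sum>t\<in>I. q t)) * (\<Prod>t\<in>I. u0 e t) + (\<Sum>i\<in>I. q i * (u1 e i * (\<Prod>t\<in>I - {i}. u0 e t)))
         = (\<Prod>t\<in>I. u0 e t) + (\<Sum>i\<in>I. q i * (u1 e i * (\<Prod>t\<in>I - {i}. u0 e t)) - q i * (\<Prod>t\<in>I. u0 e t))"
        by (simp add: sum_subtractf sum_distrib_right[symmetric] algebra_simps)
      also have "\<dots> = (\<Prod>t\<in>I. u0 e t) + (\<Sum>i\<in>I. q i * (u1 e i - u0 e i) * (\<Prod>t\<in>I - {i}. u0 e t))"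
      proof -
        have "q i * (u1 e i * (\<Prod>t\<in>I - {i}. u0 e t)) - q i * (\<Prod>t\<in>I. u0 e t)
           = q i * (u1 e i - u0 e i) * (\<Prod>t\<in>I - {i}. u0 e t)" if "i \<in> I" for i
          unfolding P[OF that] by (simp add: algebra_simps)
        then show ?thesis by simp
      qed
      \<comment> \<open>Since \<open>v\<close> enters at most one block, only first-order terms
        occur on the left. The product on the right, as for independent blocks, has higher-order
        terms too, which \<open>mono\<close> makes nonnegative.\<close>
      also have "\<dots> \<le> (\<Prod>t\<in>I. u0 e t + q t * (u1 e t - u0 e t))"
        using Suc.prems(1) u0[OF e] mono[OF e] by (rule prod_add_ge)
      also have "\<dots> = (\<Prod>t\<in>I. avg a (Suc N) (sz t) (g e t))"
        by (simp add: rec)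
      finally show "(1 - (\<Sum>t\<in>I. q t)) * (\<Prod>t\<in>I. u0 e t) + (\<Sum>i\<in>I. q i * (u1 e i * (\<Prod>t\<in>I - {i}. u0 e t)))
        \<le> (\<Prod>t\<in>I. avg a (Suc N) (sz t) (g e t))" .
      show "w e \<ge> 0" using Suc.prems(3) e by simp
    qed
    finally show ?thesis .
  qed
  moreover have "(\<Sum>o'\<in>?O. p o') = 1" unfolding sumO p_def by simp
  moreover have "p o' \<ge> 0" if "o' \<in> ?O" for o'
    using qsum q0 by (auto simp: p_def split: option.split)
  ultimately have "\<exists>o'\<in>?O. p o' > 0 \<and> \<Phi> o' \<le> ?b"
    using Suc.prems(1) by (intro exists_le_weighted_average) auto
  then obtain o' where o': "o' \<in> ?O" "p o' > 0" "\<Phi> o' \<le> ?b" by blast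
  show ?case
  proof (cases o')
    case None
    \<comment> \<open>Positive probability of \<open>None\<close> means that the blocks do not fill
      the ground set, so they fit without \<open>v\<close>.\<close>
    then have "(\<Sum>t\<in>I. q t) < 1" using o' by (simp add: p_def)
    then have "(\<Sum>t\<in>I. sz t) < Suc N"
      unfolding q_def sum_divide_distrib[symmetric] of_nat_sum[symmetric]
      by (simp del: of_nat_sum of_nat_Suc)
    then have "(\<Sum>t\<in>I. sz t) \<le> N" by simp
    have "\<exists>A. (\<forall>t\<in>I. A t \<in> nsets {a<..a+N} (sz t)) \<and> disjoint_family_on A I \<and>
      (\<Sum>e\<in>E. w e * (\<Prod>t\<in>I. g e t (A t))) \<le> (\<Sum>e\<in>E. w e * (\<Prod>t\<in>I. avg a N (sz t) (g e t)))"
      using Suc.prems(1) \<open>(\<Sum>t\<in>I. sz t) \<le> N\<close> Suc.prems(3,4) shift_incr_subset[OF Suc.prems(5) sub]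
      by (rule Suc.IH)
    then obtain A where A: "\<forall>t\<in>I. A t \<in> nsets {a<..a+N} (sz t)" "disjoint_family_on A I"
      "(\<Sum>e\<in>E. w e * (\<Prod>t\<in>I. g e t (A t))) \<le> (\<Sum>e\<in>E. w e * (\<Prod>t\<in>I. avg a N (sz t) (g e t)))"
      by blast
    have "\<Phi> o' = (\<Sum>e\<in>E. w e * (\<Prod>t\<in>I. avg a N (sz t) (g e t)))"
      unfolding None \<Phi>_def u0_def by simp
    then have "(\<Sum>e\<in>E. w e * (\<Prod>t\<in>I. g e t (A t))) \<le> ?b" using A(3) o'(3) by simp
    then show ?thesis using A(1,2) nsets_mono[OF sub] by blast
  next
    case (Some i)
    then have i: "i \<in> I" and qi: "q i > 0" using o' by (auto simp: p_def)
    then have szi: "sz i > 0" by (simp add: q_def zero_less_divide_iff)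
    define sz' where "sz' = sz(i := sz i - 1)"
    define g' where "g' e t = (if t = i then (\<lambda>A. g e t (insert v A)) else g e t)" for e t
    have "(\<Sum>t\<in>I. sz t) = sz i + (\<Sum>t\<in>I - {i}. sz t)"
      using Suc.prems(1) i by (rule sum.remove)
    moreover have "(\<Sum>t\<in>I. sz' t) = sz' i + (\<Sum>t\<in>I - {i}. sz' t)"
      using Suc.prems(1) i by (rule sum.remove)
    moreover have "(\<Sum>t\<in>I - {i}. sz' t) = (\<Sum>t\<in>I - {i}. sz t)"
      by (intro sum.cong) (auto simp: sz'_def)
    ultimately have szN: "(\<Sum>t\<in>I. sz' t) \<le> N"
      using Suc.prems(2) szi by (simp add: sz'_def)
    have sh: "shift_incr {a<..a+N} (g' e t)" if "e \<in> E" "t \<in> I" for e t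
    proof (cases "t = i")
      case True
      have "shift_incr {a<..a+N} (\<lambda>A. g e t (insert v A))"
        by (rule shift_incr_insert_top[OF Suc.prems(5)[OF that] sub vin]) (simp add: v_def)
      then show ?thesis using True by (simp add: g'_def)
    next
      case False
      then show ?thesis
        using shift_incr_subset[OF Suc.prems(5)[OF that] sub] by (simp add: g'_def)
    qed
    have "\<exists>A. (\<forall>t\<in>I. A t \<in> nsets {a<..a+N} (sz' t)) \<and> disjoint_family_on A I \<and>
      (\<Sum>e\<in>E. w e * (\<Prod>t\<in>I. g' e t (A t))) \<le> (\<Sum>e\<in>E. w e * (\<Prod>t\<in>I. avg a N (sz' t) (g' e t)))"
      using Suc.prems(1) szN Suc.prems(3) _ sh
      by (rule Suc.IH) (use Suc.prems(4) in \<open>auto simp: g'_def\<close>)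
    then obtain A where A: "\<forall>t\<in>I. A t \<in> nsets {a<..a+N} (sz' t)" "disjoint_family_on A I"
      "(\<Sum>e\<in>E. w e * (\<Prod>t\<in>I. g' e t (A t))) \<le> (\<Sum>e\<in>E. w e * (\<Prod>t\<in>I. avg a N (sz' t) (g' e t)))"
      by blast
    have "(\<Prod>t\<in>I. avg a N (sz' t) (g' e t)) = u1 e i * (\<Prod>t\<in>I - {i}. u0 e t)" for e
    proof -
      have "(\<Prod>t\<in>I. avg a N (sz' t) (g' e t))
          = avg a N (sz' i) (g' e i) * (\<Prod>t\<in>I - {i}. avg a N (sz' t) (g' e t))"
        using Suc.prems(1) i by (rule prod.remove)
      moreover have "(\<Prod>t\<in>I - {i}. avg a N (sz' t) (g' e t)) = (\<Prod>t\<in>I - {i}. u0 e t)"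
        by (intro prod.cong) (auto simp: sz'_def g'_def u0_def)
      moreover have "avg a N (sz' i) (g' e i) = u1 e i" by (simp add: sz'_def g'_def u1_def)
      ultimately show ?thesis by simp
    qed
    then have \<Phi>: "\<Phi> o' = (\<Sum>e\<in>E. w e * (\<Prod>t\<in>I. avg a N (sz' t) (g' e t)))"
      unfolding Some \<Phi>_def by simp
    define B where "B t = (if t = i then insert v (A t) else A t)" for t
    have gB: "g' e t (A t) = g e t (B t)" for e t by (simp add: g'_def B_def)
    have vA: "v \<notin> A t" if "t \<in> I" for t using A(1) that by (fastforce simp: nsets_def v_def)
    have "B t \<in> nsets {a<..a+Suc N} (sz t)" if "t \<in> I" for t
      using A(1) that sub vin szi vA[OF that] by (auto simp: B_def nsets_def sz'_def)
    moreover have "disjoint_family_on B I"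
      using A(2) vA unfolding disjoint_family_on_def B_def by auto
    moreover have "(\<Sum>e\<in>E. w e * (\<Prod>t\<in>I. g e t (B t))) \<le> ?b"
      using A(3) o'(3) unfolding \<Phi> gB by simp
    ultimately show ?thesis by blast
  qed
qed

section \<open>Exponential moments of hit counts\<close>

lemma shiftedD: "shifted V F \<Longrightarrow> A \<in> F \<Longrightarrow> x \<in> A \<Longrightarrow> y \<in> V - A \<Longrightarrow> y < x \<Longrightarrow> insert y (A - {x}) \<in> F"
  unfolding shifted_def by blast

definition dens :: "nat \<Rightarrow> nat \<Rightarrow> nat \<Rightarrow> nat set set \<Rightarrow> real" where
  "dens a N m F = real (card (F \<inter> nsets {a<..a+N} m)) / real (N choose m)"

lemma card_nsets_interval: "card (nsets {a<..a+N} m) = N choose m" for a N :: nat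
  by (simp add: card_nsets)

lemma dens_le_1: "dens a N m F \<le> 1"
proof -
  have "card (F \<inter> nsets {a<..a+N} m) \<le> N choose m"
    unfolding card_nsets_interval[of a N m, symmetric] by (intro card_mono) (auto simp: finite_imp_finite_nsets)
  then show ?thesis unfolding dens_def by (cases "m \<le> N") (simp_all add: divide_le_eq_1)
qed

lemma dens_nonneg: "0 \<le> dens a N m F"
  unfolding dens_def by simp

lemma avg_indicator:
  assumes "m \<le> N"
  shows "avg a N m (\<lambda>A. if A \<in> F then z else 1) = 1 - (1 - z) * dens a N m F"
proof -
  let ?X = "nsets {a<..a+N} m"
  have fin: "finite ?X" by (simp add: finite_imp_finite_nsets)
  have C: "real (N choose m) > 0" using assms by simp
  have "(\<Sum>A\<in>?X. if A \<in> F then z else (1::real)) = (\<Sum>A\<in>?X. 1 - (if A \<in> F then 1 - z else 0))"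
    by (intro sum.cong) auto
  also have "\<dots> = real (N choose m) - (1 - z) * real (card (F \<inter> ?X))"
    using fin by (simp add: sum_subtractf card_nsets sum.If_cases Int_commute)
  finally show ?thesis unfolding avg_def dens_def using C by (simp add: diff_divide_distrib)
qed

text \<open>Chernoff with a union bound: at most \<open>q e\<close> hits would make the term of
  \<open>e\<close> at least \<open>(1 / z) ^ q e * z ^ q e = 1\<close>, but blocks exist for which
  the whole sum is below 1. \<open>G\<close> may depend on the block, so that blocks of different
  sizes can be tested against different families.\<close>

lemma exists_blocks_many_hits:
  fixes G :: "'e \<Rightarrow> 't \<Rightarrow> nat set set" and q :: "'e \<Rightarrow> nat"
  assumes "finite I" "finite E" and sz: "(\<Sum>t\<in>I. sz t) \<le> N" and z: "0 < z" "z \<le> 1"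
    and sh: "\<And>e t. e \<in> E \<Longrightarrow> t \<in> I \<Longrightarrow> shifted {a<..a+N} (G e t)"
    and less: "(\<Sum>e\<in>E. (1 / z) ^ q e * (\<Prod>t\<in>I. 1 - (1 - z) * dens a N (sz t) (G e t))) < 1"
  shows "\<exists>A. (\<forall>t\<in>I. A t \<in> nsets {a<..a+N} (sz t)) \<and> disjoint_family_on A I \<and>
    (\<forall>e\<in>E. q e < card {t \<in> I. A t \<in> G e t})"
proof -
  define g where "g e t A = (if A \<in> G e t then z else 1)" for e t A
  have inc: "shift_incr {a<..a+N} (g e t)" if "e \<in> E" "t \<in> I" for e t
    unfolding shift_incr_def g_def using z shiftedD[OF sh[OF that]] by auto
  have "\<exists>A. (\<forall>t\<in>I. A t \<in> nsets {a<..a+N} (sz t)) \<and> disjoint_family_on A I \<and>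
    (\<Sum>e\<in>E. (1/z) ^ q e * (\<Prod>t\<in>I. g e t (A t))) \<le> (\<Sum>e\<in>E. (1/z) ^ q e * (\<Prod>t\<in>I. avg a N (sz t) (g e t)))"
    using assms(1) sz _ _ inc by (rule exists_disjoint_blocks) (use z in \<open>auto simp: g_def\<close>)
  then obtain A where A: "\<forall>t\<in>I. A t \<in> nsets {a<..a+N} (sz t)" "disjoint_family_on A I"
    "(\<Sum>e\<in>E. (1/z) ^ q e * (\<Prod>t\<in>I. g e t (A t))) \<le> (\<Sum>e\<in>E. (1/z) ^ q e * (\<Prod>t\<in>I. avg a N (sz t) (g e t)))"
    by blast
  have "sz t \<le> N" if "t \<in> I" for t using member_le_sum[of t I sz] assms(1) that sz by simp
  then have "(\<Prod>t\<in>I. avg a N (sz t) (g e t)) = (\<Prod>t\<in>I. 1 - (1 - z) * dens a N (sz t) (G e t))" for e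
    unfolding g_def[abs_def] by (intro prod.cong) (simp_all add: avg_indicator)
  then have lt: "(\<Sum>e\<in>E. (1/z) ^ q e * (\<Prod>t\<in>I. g e t (A t))) < 1" using A(3) less by simp
  have "q e < card {t \<in> I. A t \<in> G e t}" if e: "e \<in> E" for e
  proof (rule ccontr)
    define h where "h = card {t \<in> I. A t \<in> G e t}"
    assume "\<not> ?thesis"
    then have h: "h \<le> q e" by (simp add: h_def)
    have "(\<Prod>t\<in>I. g e t (A t)) = z ^ h"
      unfolding g_def h_def using assms(1) by (simp add: prod.If_cases Collect_conj_eq)
    moreover have "z ^ h \<ge> z ^ q e" using z h by (intro power_decreasing) auto
    ultimately have "(1/z) ^ q e * (\<Prod>t\<in>I. g e t (A t)) \<ge> (1/z)^q e * z ^ q e"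
      using z by (intro mult_left_mono) auto
    moreover have "(1/z)^q e * z ^ q e = 1" using z by (simp add: power_mult_distrib[symmetric])
    moreover have "(1/z) ^ q e * (\<Prod>t\<in>I. g e t (A t)) \<le> (\<Sum>e\<in>E. (1/z) ^ q e * (\<Prod>t\<in>I. g e t (A t)))"
      using z e assms(2)
      by (intro member_le_sum[of e E "\<lambda>e. (1/z) ^ q e * (\<Prod>t\<in>I. g e t (A t))"])
         (auto simp: g_def intro!: mult_nonneg_nonneg prod_nonneg)
    ultimately show False using lt by simp
  qed
  then show ?thesis using A by blast
qed

section \<open>Shifted families\<close>

text \<open>Greedy choice in order of increasing \<open>r\<close>: the values of \<open>r\<close> up
  to that of \<open>x\<close> are distinct members of \<open>{1..r x}\<close>, so fewer than
  \<open>r x\<close> elements are taken when \<open>x\<close> is served.\<close>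

lemma exists_distinct_representatives:
  fixes r :: "'i \<Rightarrow> nat"
  assumes "finite I" "inj_on r I" "\<And>i. i \<in> I \<Longrightarrow> 1 \<le> r i \<and> r i \<le> card (H i)"
  shows "\<exists>f. inj_on f I \<and> (\<forall>i\<in>I. f i \<in> H i)"
  using assms
proof (induction I rule: finite_ranking_induct[where f = r])
  case empty
  then show ?case by simp
next
  case (insert x S)
  show ?case
  proof (cases "x \<in> S")
    case True
    then show ?thesis using insert by (simp add: insert_absorb)
  next
    case False
    obtain f where f: "inj_on f S" "\<forall>i\<in>S. f i \<in> H i"
      using insert by (auto simp: inj_on_insert)
    have "r ` insert x S \<subseteq> {1..r x}" using insert by auto
    then have "card (r ` insert x S) \<le> r x" using card_mono[of "{1..r x}"] by fastforce
    then have "Suc (card S) \<le> card (H x)"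
      using insert.prems insert.hyps False by (fastforce simp: card_image)
    then have "card (f ` S) < card (H x)" using insert.hyps card_image_le[of S f] by linarith
    then have "\<not> H x \<subseteq> f ` S" using card_mono[of "f ` S" "H x"] insert.hyps by auto
    then obtain y where y: "y \<in> H x" "y \<notin> f ` S" by blast
    have "inj_on (f(x := y)) (insert x S) \<and> (\<forall>i\<in>insert x S. (f(x := y)) i \<in> H i)"
      using f y False by (auto simp: inj_on_def)
    then show ?thesis by blast
  qed
qed

section \<open>The shifting order and the progression\<close>

text \<open>The counting condition says that \<open>B\<close> lies elementwise below
  \<open>A\<close>. Exchange the largest element \<open>y\<close> of \<open>A - B\<close> for the
  largest element \<open>x\<close> of \<open>B - A\<close>. The counts of \<open>A\<close> grow only
  for \<open>v\<close> between \<open>x\<close> and \<open>y\<close>, and there maximality of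
  \<open>x\<close> puts \<open>B\<close> strictly ahead, so the condition survives.\<close>

lemma shifted_dominated:
  assumes sh: "shifted V F" and "A \<in> F" and B: "B \<subseteq> V" "finite B"
    and "finite A" "card A = card B" "\<And>v. card (A \<inter> {..<v}) \<le> card (B \<inter> {..<v})"
  shows "B \<in> F"
  using assms(2,5-)
proof (induction "card (A - B)" arbitrary: A)
  case 0
  then have "A \<subseteq> B" by auto
  then show ?case using 0 B card_subset_eq by blast
next
  case (Suc m)
  have split: "card (S \<inter> {..<v}) + card (S \<inter> {v..}) = card S" if "finite S" for S :: "nat set" and v
    using card_Int_Diff[OF that, of "{..<v}"] by (simp add: Diff_eq Compl_lessThan)
  have "A - B \<noteq> {}" using Suc.hyps(2) by force
  have "B - A \<noteq> {}"
  proof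
    assume "B - A = {}"
    then have "B = A" using Suc.prems by (intro card_subset_eq) auto
    then show False using \<open>A - B \<noteq> {}\<close> by simp
  qed
  define y where "y = Max (A - B)"
  define x where "x = Max (B - A)"
  have y: "y \<in> A - B" "\<And>u. u \<in> A - B \<Longrightarrow> u \<le> y"
    unfolding y_def using Suc.prems \<open>A - B \<noteq> {}\<close> by (auto intro: Max_ge simp del: Diff_iff intro!: Max_in)
  have x: "x \<in> B - A" "\<And>u. u \<in> B - A \<Longrightarrow> u \<le> x"
    unfolding x_def using B \<open>B - A \<noteq> {}\<close> by (auto intro: Max_ge simp del: Diff_iff intro!: Max_in)
  have "x < y"
  proof (rule ccontr)
    assume "\<not> x < y"
    have "A \<inter> {x..} \<subset> B \<inter> {x..}"
    proof
      show "A \<inter> {x..} \<subseteq> B \<inter> {x..}"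
      proof
        fix u assume u: "u \<in> A \<inter> {x..}"
        have "u \<noteq> x" "u \<noteq> y \<or> y \<noteq> x" using u x(1) y(1) by auto
        then have "\<not> u \<le> y" using u \<open>\<not> x < y\<close> by auto
        then show "u \<in> B \<inter> {x..}" using u y(2)[of u] by auto
      qed
    qed (use x(1) in auto)
    then have "card (A \<inter> {x..}) < card (B \<inter> {x..})" using B by (intro psubset_card_mono) auto
    then show False using split[OF B(2), of x] split[OF Suc.prems(2), of x] Suc.prems(3) Suc.prems(4)[of x]
      by linarith
  qed
  define A' where "A' = insert x (A - {y})"
  have "A' - B = (A - B) - {y}" using x y unfolding A'_def by auto
  then have "card (A' - B) = m" using Suc.hyps(2) y(1) Suc.prems(2) by simp
  moreover have "A' \<in> F" unfolding A'_def using x y B \<open>x < y\<close> by (intro shiftedD[OF sh Suc.prems(1)]) auto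
  moreover have "finite A'" "card A' = card B"
    using Suc.prems x(1) card_Suc_Diff1[OF Suc.prems(2), of y] y(1) unfolding A'_def by simp_all
  moreover have "card (A' \<inter> {..<v}) \<le> card (B \<inter> {..<v})" for v
  proof -
    consider "v \<le> x" | "x < v" "v \<le> y" | "y < v" by linarith
    then show ?thesis
    proof cases
      case 1
      then have "A' \<inter> {..<v} = A \<inter> {..<v}" using \<open>x < y\<close> unfolding A'_def by auto
      then show ?thesis using Suc.prems(4) by simp
    next
      case 2
      then have "B \<inter> {v..} \<subset> A \<inter> {v..}" using x(2) y(1) by fastforce
      then have "card (B \<inter> {v..}) < card (A \<inter> {v..})"
        using Suc.prems(2) by (intro psubset_card_mono) auto
      moreover have "A' \<inter> {..<v} = insert x (A \<inter> {..<v})" using 2 unfolding A'_def by auto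
      then have "card (A' \<inter> {..<v}) \<le> Suc (card (A \<inter> {..<v}))" by (simp add: card_insert_le_m1 card_insert_if)
      ultimately show ?thesis
        using split[OF B(2), of v] split[OF Suc.prems(2), of v] Suc.prems(3) by linarith
    next
      case 3
      have "A' \<inter> {v..} = A \<inter> {v..}" using 3 \<open>x < y\<close> unfolding A'_def by auto
      then have "card (A' \<inter> {v..}) = card (A \<inter> {v..})" by simp
      then show ?thesis
        using split[OF \<open>finite A'\<close>, of v] split[OF Suc.prems(2), of v] \<open>card A' = card B\<close> Suc.prems(3)
          Suc.prems(4)[of v] by linarith
    qed
  qed
  ultimately show ?case using Suc.hyps(1) by blast
qed

text \<open>The last hypothesis places the \<open>l\<close>-th smallest element of \<open>A\<close>
  at \<open>s + c * l\<close> or later, so the progression lies below \<open>A\<close>.\<close>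

lemma progression_mem_shifted:
  assumes "shifted {1..n} F" "A \<in> F" "A \<in> nsets {s<..n} k" "s + c * k \<le> n" "0 < c"
    and "\<And>l. l \<in> {1..k} \<Longrightarrow> card (A \<inter> {s<..<s + c * l}) < l"
  shows "(\<lambda>l. s + c * l) ` {1..k} \<in> F"
proof (rule shifted_dominated[OF assms(1,2)])
  let ?D = "(\<lambda>l. s + c * l) ` {1..k}"
  have inj: "inj_on (\<lambda>l. s + c * l) S" for S using assms(5) by (auto simp: inj_on_def)
  have "s + c * l \<le> n" if "l \<le> k" for l
    using that assms(4) by (meson add_left_mono le_trans mult_le_mono2)
  then show "?D \<subseteq> {1..n}" using assms(5) by (auto simp: Suc_le_eq)
  show "finite ?D" "finite A" "card A = card ?D"
    using assms(3) inj by (auto simp: nsets_def card_image)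
  show "card (A \<inter> {..<v}) \<le> card (?D \<inter> {..<v})" for v
  proof (cases "card (A \<inter> {..<v}) = 0")
    case False
    define p where "p = card (A \<inter> {..<v})"
    have "p \<le> card A" unfolding p_def using \<open>finite A\<close> by (intro card_mono) auto
    moreover have "p \<noteq> 0" unfolding p_def by (rule False)
    ultimately have p: "p \<in> {1..k}" using assms(3) by (simp add: nsets_def)
    have "s + c * p < v"
    proof (rule ccontr)
      assume "\<not> ?thesis"
      then have "A \<inter> {..<v} \<subseteq> A \<inter> {s<..<s + c * p}" using assms(3) by (auto simp: nsets_def)
      then have "p \<le> card (A \<inter> {s<..<s + c * p})"
        unfolding p_def using \<open>finite A\<close> by (intro card_mono) auto
      then show False using assms(6)[OF p] by simp
    qed
    then have "s + c * l < v" if "l \<le> p" for l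
      using that by (meson add_left_mono le_less_trans mult_le_mono2)
    then have "(\<lambda>l. s + c * l) ` {1..p} \<subseteq> ?D \<inter> {..<v}" using p by auto
    then have "card ((\<lambda>l. s + c * l) ` {1..p}) \<le> card (?D \<inter> {..<v})" by (intro card_mono) auto
    then show ?thesis using inj by (simp add: card_image p_def)
  qed simp
qed

text \<open>Here the \<open>l\<close>-th smallest element of \<open>B\<close> is at most
  \<open>s + c * l\<close>, so \<open>B\<close> lies below the progression.\<close>

lemma mem_of_progression_mem_shifted:
  assumes "shifted {1..n} F" "(\<lambda>l. s + c * l) ` {1..k} \<in> F" "B \<in> nsets {s<..n} k" "0 < c"
    and "\<And>l. l \<in> {1..k} \<Longrightarrow> l \<le> card (B \<inter> {s<..s + c * l})"
  shows "B \<in> F"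
proof (rule shifted_dominated[OF assms(1,2)])
  let ?D = "(\<lambda>l. s + c * l) ` {1..k}"
  have inj: "inj_on (\<lambda>l. s + c * l) S" for S using assms(4) by (auto simp: inj_on_def)
  show "B \<subseteq> {1..n}" "finite B" "finite ?D" "card ?D = card B"
    using assms(3) inj by (auto simp: nsets_def card_image)
  show "card (?D \<inter> {..<v}) \<le> card (B \<inter> {..<v})" for v
  proof -
    define J where "J = {l\<in>{1..k}. s + c * l < v}"
    have DJ: "?D \<inter> {..<v} = (\<lambda>l. s + c * l) ` J" unfolding J_def by auto
    have cJ: "card (?D \<inter> {..<v}) = card J" unfolding DJ using inj by (simp add: card_image)
    show ?thesis
    proof (cases "J = {}")
      case True then show ?thesis using cJ by simp
    next
      case False
      have fin: "finite J" unfolding J_def by simp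
      define p where "p = Max J"
      have p: "p \<in> J" unfolding p_def using fin False by (rule Max_in)
      have "J \<subseteq> {1..p}" unfolding p_def using fin by (auto simp: J_def)
      then have "card J \<le> p" using card_mono[of "{1..p}" J] by simp
      also have "p \<le> card (B \<inter> {s<..s + c * p})" using p assms(5) by (simp add: J_def)
      also have "\<dots> \<le> card (B \<inter> {..<v})"
        using p \<open>finite B\<close> by (intro card_mono) (auto simp: J_def)
      finally show ?thesis using cJ by simp
    qed
  qed
qed

text \<open>All sets grow by one element per level. Before level \<open>Suc k\<close> they occupy at
  most \<open>card P * k\<close> of the \<open>q * Suc k\<close> available elements, which leaves at
  least \<open>card P\<close> fresh ones.\<close>

lemma exists_disjoint_early_sets:
  assumes "finite P" "card P \<le> q" "finite R"
    and "\<And>l. l \<in> {1..k} \<Longrightarrow> q * l \<le> card (R \<inter> {s<..s + c * l})"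
  shows "\<exists>f. (\<forall>i\<in>P. f i \<in> nsets (R \<inter> {s<..s + c * k}) k \<and>
     (\<forall>l\<in>{1..k}. l \<le> card (f i \<inter> {s<..s + c * l}))) \<and> disjoint_family_on f P"
  using assms(4)
proof (induction k)
  case 0
  then show ?case by (intro exI[of _ "\<lambda>_. {}"]) (auto simp: disjoint_family_on_def)
next
  case (Suc k)
  obtain f where f: "\<And>i. i \<in> P \<Longrightarrow> f i \<in> nsets (R \<inter> {s<..s + c * k}) k"
    "\<And>i l. i \<in> P \<Longrightarrow> l \<in> {1..k} \<Longrightarrow> l \<le> card (f i \<inter> {s<..s + c * l})" "disjoint_family_on f P"
  proof -
    have "\<And>l. l \<in> {1..k} \<Longrightarrow> q * l \<le> card (R \<inter> {s<..s + c * l})" using Suc.prems by auto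
    from Suc.IH[OF this] show ?thesis using that by blast
  qed
  let ?U = "\<Union>i\<in>P. f i" and ?R = "R \<inter> {s<..s + c * Suc k}"
  have "card ?U \<le> (\<Sum>i\<in>P. card (f i))" using assms(1) by (rule card_UN_le)
  also have "\<dots> = card P * k" using f(1) by (simp add: nsets_def)
  finally have U: "card ?U \<le> card P * k" .
  have "finite ?U" using assms(1) f(1) by (auto simp: nsets_def)
  then have "card ?R - card ?U \<le> card (?R - ?U)" by (rule diff_card_le_card_Diff)
  moreover have "q * Suc k \<le> card ?R" using Suc.prems[of "Suc k"] by simp
  moreover have "card P * k \<le> q * k" using assms(2) by simp
  ultimately have "card P \<le> card (?R - ?U)" using U assms(2) unfolding mult_Suc_right by linarith
  then obtain h where h: "h ` P \<subseteq> ?R - ?U" "inj_on h P"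
    using card_le_inj[of P "?R - ?U"] assms(1,3) by auto
  have sub: "{s<..s + c * k} \<subseteq> {s<..s + c * Suc k}" by auto
  define f' where "f' i = insert (h i) (f i)" for i
  have new: "h i \<notin> f j" "h i \<in> ?R" if "i \<in> P" "j \<in> P" for i j using h(1) that by blast+
  have "f' i \<in> nsets ?R (Suc k)" if "i \<in> P" for i
    using f(1)[OF that] new[OF that that] sub by (auto simp: f'_def nsets_def)
  moreover have "l \<le> card (f' i \<inter> {s<..s + c * l})" if "i \<in> P" "l \<in> {1..Suc k}" for i l
  proof (cases "l = Suc k")
    case True
    have "f' i \<inter> {s<..s + c * l} = f' i" using calculation[OF that(1)] True by (auto simp: nsets_def)
    then show ?thesis using calculation[OF that(1)] True by (simp add: nsets_def)
  next
    case False
    have "card (f i \<inter> {s<..s + c * l}) \<le> card (f' i \<inter> {s<..s + c * l})"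
      by (intro card_mono) (auto simp: f'_def)
    then show ?thesis using f(2)[of i l] that False by fastforce
  qed
  moreover have "disjoint_family_on f' P"
    unfolding disjoint_family_on_def
  proof (intro ballI impI)
    fix i j assume ij: "i \<in> P" "j \<in> P" "i \<noteq> j"
    then have "f i \<inter> f j = {}" "h i \<noteq> h j" using f(3) h(2) by (auto simp: disjoint_family_on_def inj_on_def)
    then show "f' i \<inter> f' j = {}" using new[of i j] new[of j i] ij unfolding f'_def by auto
  qed
  ultimately show ?case by blast
qed

text \<open>Katona's shadow bound in the form due to Frankl: give each pair of a set \<open>F\<close> and an element of
  its initial segment at the last level \<open>l\<close> with \<open>l \<le> card (F \<inter> {s<..<s + c * l})\<close> the weight
  \<open>1 / l\<close>; the level can be recovered from \<open>F - {x}\<close>.\<close>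

lemma card_le_shadow:
  assumes "0 < c" "finite D"
    and fin: "\<And>F. F \<in> \<G> \<Longrightarrow> finite F \<and> card F = k"
    and shadow: "\<And>F x. F \<in> \<G> \<Longrightarrow> x \<in> F \<Longrightarrow> F - {x} \<in> D"
    and early: "\<And>F. F \<in> \<G> \<Longrightarrow> \<exists>l\<in>{1..k}. l \<le> card (F \<inter> {s<..<s + c * l})"
    and "finite \<G>"
  shows "card \<G> \<le> (c - 1) * card D"
proof -
  define W where "W l = {s<..<s + c * l}" for l
  have W_mono: "W l \<subseteq> W l'" if "l \<le> l'" for l l'
  proof -
    have "s + c * l \<le> s + c * l'" using that by simp
    then show ?thesis unfolding W_def subset_iff greaterThanLessThan_iff by linarith
  qed
  define L where "L F = {l\<in>{1..k}. l \<le> card (F \<inter> W l)}" for F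
  define lev where "lev F = Max (L F)" for F
  have L: "finite (L F)" for F unfolding L_def by simp
  have lev_in: "lev F \<in> L F" if "F \<in> \<G>" for F
    unfolding lev_def using L early[OF that] by (intro Max_in) (auto simp: L_def W_def)
  have lev_max: "l \<le> lev F" if "l \<in> L F" for l F
    unfolding lev_def using L that by (intro Max_ge)
  have lev_card: "card (F \<inter> W (lev F)) = lev F" if F: "F \<in> \<G>" for F
  proof (rule ccontr)
    assume neq: "card (F \<inter> W (lev F)) \<noteq> lev F"
    have 1: "1 \<le> lev F" "lev F \<le> k" "lev F \<le> card (F \<inter> W (lev F))" using lev_in[OF F] by (auto simp: L_def)
    then have 2: "Suc (lev F) \<le> card (F \<inter> W (lev F))" using neq by simp
    also have "\<dots> \<le> card F" using fin[OF F] by (intro card_mono) auto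
    finally have "Suc (lev F) \<le> k" using fin[OF F] by simp
    moreover have "card (F \<inter> W (lev F)) \<le> card (F \<inter> W (Suc (lev F)))"
      using fin[OF F] W_mono[of "lev F" "Suc (lev F)"] by (intro card_mono) auto
    ultimately have "Suc (lev F) \<in> L F" using 2 by (auto simp: L_def)
    then show False using lev_max by fastforce
  qed
  define Pr where "Pr = Sigma \<G> (\<lambda>F. F \<inter> W (lev F))"
  define del where "del = (\<lambda>(F, x). F - {x :: nat})"
  have finP: "finite Pr" unfolding Pr_def using assms(6) fin by auto
  \<comment> \<open>All preimages of \<open>E\<close> share one level \<open>l\<close>. The open
    window \<open>W l\<close> has \<open>c * l - 1\<close> elements, of which \<open>E\<close>
    contains \<open>l - 1\<close>, so at most \<open>(c - 1) * l\<close> elements can have been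
    deleted, each with weight \<open>1 / l\<close>.\<close>
  have fiber: "(\<Sum>p\<in>{p \<in> Pr. del p = E}. 1 / real (lev (fst p))) \<le> real (c - 1)" for E
  proof (cases "{p \<in> Pr. del p = E} = {}")
    case False
    then obtain F0 x0 where "(F0, x0) \<in> Pr" "F0 - {x0} = E" by (auto simp: del_def)
    then have F0: "F0 \<in> \<G>" "x0 \<in> F0" "x0 \<in> W (lev F0)" "E = F0 - {x0}" by (auto simp: Pr_def)
    have cE: "card (E \<inter> W l) = card (F \<inter> W l) - 1" if "F \<in> \<G>" "x \<in> F" "x \<in> W l" "F - {x} = E" for F x l
    proof -
      have "E \<inter> W l = (F \<inter> W l) - {x}" using that by auto
      then show ?thesis using that fin by (simp add: card_Diff_singleton)
    qed
    \<comment> \<open>Both deleted elements lie in the wider window, and \<open>E\<close> is the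
      same, so \<open>F\<close> has as many elements there as \<open>F'\<close>; hence
      \<open>F\<close> would reach the higher level as well.\<close>
    have not_less: "\<not> lev F < lev F'"
      if F: "F \<in> \<G>" "x \<in> F" "x \<in> W (lev F)" "F - {x} = E"
        "F' \<in> \<G>" "x' \<in> F'" "x' \<in> W (lev F')" "F' - {x'} = E" for F F' x x'
    proof
      assume less: "lev F < lev F'"
      then have "x \<in> W (lev F')" using F(3) W_mono[of "lev F" "lev F'"] by auto
      then have "card (F \<inter> W (lev F')) - 1 = card (F' \<inter> W (lev F')) - 1"
        using cE F by metis
      moreover have "card (F \<inter> W (lev F')) > 0"
        using \<open>x \<in> W (lev F')\<close> F(1,2) fin by (auto simp: card_gt_0_iff)
      moreover have "lev F' \<in> {1..k}" using lev_in[OF F(5)] by (simp add: L_def)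
      ultimately have "lev F' \<in> L F" using lev_card[OF F(5)] by (auto simp: L_def)
      then show False using lev_max less by fastforce
    qed
    have same: "lev F = lev F0" if "(F, x) \<in> Pr" "F - {x} = E" for F x
    proof -
      have F: "F \<in> \<G>" "x \<in> F" "x \<in> W (lev F)" using that(1) by (auto simp: Pr_def)
      show ?thesis
        using not_less[OF F that(2) F0(1-3) F0(4)[symmetric]]
          not_less[OF F0(1-3) F0(4)[symmetric] F that(2)] by simp
    qed
    define l where "l = lev F0"
    have l: "l \<in> {1..k}" using lev_in[OF F0(1)] by (simp add: L_def l_def)
    have inj: "inj_on snd {p \<in> Pr. del p = E}"
      by (auto simp: inj_on_def del_def Pr_def)
    have "snd ` {p \<in> Pr. del p = E} \<subseteq> W l - (E \<inter> W l)"
      using same by (fastforce simp: Pr_def del_def l_def)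
    then have "card {p \<in> Pr. del p = E} \<le> card (W l - (E \<inter> W l))"
      unfolding card_image[OF inj, symmetric] by (intro card_mono) (auto simp: W_def)
    also have "\<dots> = card (W l) - card (E \<inter> W l)"
      by (rule card_Diff_subset) (auto simp: W_def)
    also have "\<dots> = (c * l - 1) - (l - 1)"
      using cE[of F0 x0 l] F0 lev_card[OF F0(1)] by (simp add: W_def l_def)
    also have "\<dots> = (c - 1) * l" using l by (auto simp: algebra_simps)
    finally have card: "card {p \<in> Pr. del p = E} \<le> (c - 1) * l" .
    have "(\<Sum>p\<in>{p \<in> Pr. del p = E}. 1 / real (lev (fst p))) = (\<Sum>p\<in>{p \<in> Pr. del p = E}. 1 / real l)"
      using same by (intro sum.cong refl) (auto simp: del_def l_def)
    also have "\<dots> = real (card {p \<in> Pr. del p = E}) / real l" by simp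
    also have "\<dots> \<le> real ((c - 1) * l) / real l"
      using card by (intro divide_right_mono) (simp_all only: of_nat_le_iff of_nat_0_le_iff)
    also have "\<dots> = real (c - 1)" using l by simp
    finally show ?thesis .
  next
    case True
    show ?thesis unfolding True by simp
  qed
  have "real (card \<G>) = (\<Sum>F\<in>\<G>. \<Sum>x\<in>F \<inter> W (lev F). 1 / real (lev F))"
  proof -
    have "(\<Sum>x\<in>F \<inter> W (lev F). 1 / real (lev F)) = 1" if "F \<in> \<G>" for F
      using lev_card[OF that] lev_in[OF that] by (simp add: L_def)
    then have "(\<Sum>F\<in>\<G>. \<Sum>x\<in>F \<inter> W (lev F). 1 / real (lev F)) = (\<Sum>F\<in>\<G>. 1)"
      by (intro sum.cong refl)
    then show ?thesis by simp
  qed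
  also have "\<dots> = (\<Sum>(F, x)\<in>Pr. 1 / real (lev F))"
    unfolding Pr_def using assms(6) fin by (intro sum.Sigma) auto
  also have "\<dots> = (\<Sum>p\<in>Pr. 1 / real (lev (fst p)))" by (simp add: case_prod_beta)
  also have "\<dots> = (\<Sum>E\<in>D. \<Sum>p\<in>{p \<in> Pr. del p = E}. 1 / real (lev (fst p)))"
    using finP assms(2) by (intro sum.group[symmetric]) (auto simp: Pr_def del_def intro: shadow)
  also have "\<dots> \<le> (\<Sum>E\<in>D. real (c - 1))" by (intro sum_mono fiber)
  also have "\<dots> = real ((c - 1) * card D)" by simp
  finally show ?thesis unfolding of_nat_le_iff .
qed

section \<open>Simultaneous shifting (compression) of cross-dependent families\<close>

definition shift_set :: "nat \<Rightarrow> nat \<Rightarrow> nat set set \<Rightarrow> nat set \<Rightarrow> nat set" where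
  "shift_set x y F A = (if y \<in> A \<and> x \<notin> A \<and> insert x (A - {y}) \<notin> F then insert x (A - {y}) else A)"

lemma inj_on_shift_set: "inj_on (shift_set x y F) F"
proof (rule inj_onI)
  fix A B assume AB: "A \<in> F" "B \<in> F" "shift_set x y F A = shift_set x y F B"
  have "A = B" if "y \<in> A" "y \<in> B" "x \<notin> A" "x \<notin> B" "insert x (A - {y}) = insert x (B - {y})"
    using that by (metis Diff_insert_absorb insert_Diff insert_ident Diff_iff)
  then show "A = B" using AB unfolding shift_set_def by (auto split: if_splits)
qed

lemma shift_set_memD:
  assumes "B \<in> shift_set x y F ` F"
  shows "(B \<in> F \<and> (y \<in> B \<and> x \<notin> B \<longrightarrow> insert x (B - {y}) \<in> F)) \<or>
    (x \<in> B \<and> y \<notin> B \<and> insert y (B - {x}) \<in> F)"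
proof -
  obtain A where A: "A \<in> F" "B = shift_set x y F A" using assms by auto
  show ?thesis
  proof (cases "y \<in> A \<and> x \<notin> A \<and> insert x (A - {y}) \<notin> F")
    case True
    then have "B = insert x (A - {y})" "x \<noteq> y" using A by (auto simp: shift_set_def)
    moreover from this have "insert y (B - {x}) = A" using True by auto
    ultimately show ?thesis using A(1) by auto
  next
    case False
    then show ?thesis using A by (auto simp: shift_set_def)
  qed
qed

text \<open>In a disjoint choice from the shifted families some \<open>B i0\<close> is new, so it
  contains \<open>x\<close>, and no other member does. Swapping \<open>x\<close> and
  \<open>y\<close> everywhere undoes the shift of \<open>B i0\<close>; another member containing
  \<open>y\<close> was left in place only because its shift is already in its family, so its image
  is there too.\<close>

lemma cross_dependent_shift:
  assumes "cross_dependent I \<F>" "x \<noteq> y"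
  shows "cross_dependent I (\<lambda>i. shift_set x y (\<F> i) ` \<F> i)"
  unfolding cross_dependent_def
proof
  assume "\<exists>B. (\<forall>i\<in>I. B i \<in> shift_set x y (\<F> i) ` \<F> i) \<and> disjoint_family_on B I"
  then obtain B where B: "\<And>i. i \<in> I \<Longrightarrow> B i \<in> shift_set x y (\<F> i) ` \<F> i" "disjoint_family_on B I"
    by blast
  obtain i0 where i0: "i0 \<in> I" "B i0 \<notin> \<F> i0"
    using B assms(1) unfolding cross_dependent_def by blast
  have x0: "x \<in> B i0" "y \<notin> B i0" "insert y (B i0 - {x}) \<in> \<F> i0"
    using shift_set_memD[OF B(1)[OF i0(1)]] i0(2) by blast+
  define \<tau> where "\<tau> = id(x := y, y := x)"
  have inj: "inj \<tau>" using assms(2) by (auto simp: \<tau>_def inj_def)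
  have "\<tau> ` B i \<in> \<F> i" if i: "i \<in> I" for i
  proof (cases "i = i0")
    case True
    have "\<tau> ` B i0 = insert y (B i0 - {x})"
      using x0(1,2) assms(2) by (auto simp: \<tau>_def image_iff)
    then show ?thesis using True x0 by simp
  next
    case False
    then have "x \<notin> B i" using B(2) i0(1) i x0(1) by (auto simp: disjoint_family_on_def)
    then have *: "B i \<in> \<F> i" "y \<in> B i \<Longrightarrow> insert x (B i - {y}) \<in> \<F> i"
      using shift_set_memD[OF B(1)[OF i]] by blast+
    show ?thesis
    proof (cases "y \<in> B i")
      case True
      then have "\<tau> ` B i = insert x (B i - {y})"
        using \<open>x \<notin> B i\<close> by (auto simp: \<tau>_def image_iff)
      then show ?thesis using * True by simp
    next
      case False
      then have "\<tau> ` B i = B i" using \<open>x \<notin> B i\<close> by (auto simp: \<tau>_def image_iff)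
      then show ?thesis using * by simp
    qed
  qed
  moreover have "disjoint_family_on (\<lambda>i. \<tau> ` B i) I"
    using B(2) inj by (auto simp: disjoint_family_on_def image_Int[symmetric])
  ultimately have "\<exists>B. (\<forall>i\<in>I. B i \<in> \<F> i) \<and> disjoint_family_on B I"
    by (intro exI[of _ "\<lambda>i. \<tau> ` B i"]) simp
  then show False using assms(1) unfolding cross_dependent_def by contradiction
qed

lemma sum_shift_set_le:
  assumes "finite A" "x < y"
  shows "\<Sum>(shift_set x y F A) \<le> \<Sum>A"
    and "shift_set x y F A \<noteq> A \<Longrightarrow> \<Sum>(shift_set x y F A) < \<Sum>A"
proof -
  have "\<Sum>(insert x (A - {y})) < \<Sum>A" if "y \<in> A" "x \<notin> A"
    using assms that by (simp add: sum.remove[OF assms(1) that(1)])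
  then have "shift_set x y F A = A \<or> \<Sum>(shift_set x y F A) < \<Sum>A"
    unfolding shift_set_def by simp
  then show "\<Sum>(shift_set x y F A) \<le> \<Sum>A"
    and "shift_set x y F A \<noteq> A \<Longrightarrow> \<Sum>(shift_set x y F A) < \<Sum>A"
    by fastforce+
qed

text \<open>Among all cross-dependent families of the given sizes take one with the least total sum
  of elements; a shift that changes anything would lower this sum.\<close>

lemma exists_shifted_families:
  assumes "finite I" "\<And>i. i \<in> I \<Longrightarrow> \<F> i \<subseteq> nsets {1..n} k" "cross_dependent I \<F>"
  shows "\<exists>\<F>'. (\<forall>i\<in>I. \<F>' i \<subseteq> nsets {1..n} k \<and> card (\<F>' i) = card (\<F> i) \<and> shifted {1..n} (\<F>' i)) \<and>
    cross_dependent I \<F>'"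
proof -
  define M where "M \<F>' = (\<Sum>i\<in>I. \<Sum>A\<in>\<F>' i. \<Sum>A)" for \<F>' :: "'a \<Rightarrow> nat set set"
  define ok where "ok \<F>' \<longleftrightarrow> (\<forall>i\<in>I. \<F>' i \<subseteq> nsets {1..n} k \<and> card (\<F>' i) = card (\<F> i)) \<and> cross_dependent I \<F>'"
    for \<F>'
  have "ok \<F>" using assms by (simp add: ok_def)
  then obtain \<H> where H: "ok \<H>" "\<And>\<H>'. ok \<H>' \<Longrightarrow> M \<H> \<le> M \<H>'"
    using ex_has_least_nat[of ok \<F> M] by blast
  have "shifted {1..n} (\<H> i0)" if i0: "i0 \<in> I" for i0
  proof (rule ccontr)
    assume "\<not> ?thesis"
    then obtain A x y where A: "A \<in> \<H> i0" "y \<in> A" "x \<in> {1..n} - A" "x < y" "insert x (A - {y}) \<notin> \<H> i0"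
      unfolding shifted_def by blast
    define \<H>' where "\<H>' i = shift_set x y (\<H> i) ` \<H> i" for i
    have sub: "\<H> i \<subseteq> nsets {1..n} k" if "i \<in> I" for i using H(1) that by (simp add: ok_def)
    have finH: "finite (\<H> i)" if "i \<in> I" for i
      by (rule finite_subset[OF sub[OF that]]) (simp add: finite_imp_finite_nsets)
    have finA: "finite B" if "i \<in> I" "B \<in> \<H> i" for i B using sub[OF that(1)] that(2) by (auto simp: nsets_def)
    have "ok \<H>'"
      unfolding ok_def
    proof (intro conjI ballI)
      fix i assume i: "i \<in> I"
      show "\<H>' i \<subseteq> nsets {1..n} k"
      proof
        fix B assume "B \<in> \<H>' i"
        then obtain B0 where B0: "B0 \<in> \<H> i" "B = shift_set x y (\<H> i) B0" by (auto simp: \<H>'_def)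
        have "B0 \<in> nsets {1..n} k" using B0 sub[OF i] by auto
        then show "B \<in> nsets {1..n} k"
          using A(3) card_Suc_Diff1[of B0 y] unfolding B0(2) shift_set_def by (auto simp: nsets_def)
      qed
      show "card (\<H>' i) = card (\<F> i)"
        unfolding \<H>'_def card_image[OF inj_on_shift_set] using H(1) i by (simp add: ok_def)
    next
      show "cross_dependent I \<H>'"
        unfolding \<H>'_def using H(1) A(4) by (intro cross_dependent_shift) (auto simp: ok_def)
    qed
    then have "M \<H> \<le> M \<H>'" by (rule H(2))
    moreover have "M \<H>' < M \<H>"
    proof -
      have eq: "(\<Sum>B\<in>\<H>' i. \<Sum>B) = (\<Sum>B\<in>\<H> i. \<Sum>(shift_set x y (\<H> i) B))" for i
        unfolding \<H>'_def by (subst sum.reindex[OF inj_on_shift_set]) simp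
      have "(\<Sum>B\<in>\<H> i. \<Sum>(shift_set x y (\<H> i) B)) \<le> (\<Sum>B\<in>\<H> i. \<Sum>B)" if "i \<in> I" for i
        using sum_shift_set_le(1)[OF finA[OF that] A(4)] by (intro sum_mono) auto
      moreover have "(\<Sum>B\<in>\<H> i0. \<Sum>(shift_set x y (\<H> i0) B)) < (\<Sum>B\<in>\<H> i0. \<Sum>B)"
      proof (rule sum_strict_mono_ex1)
        show "\<exists>B\<in>\<H> i0. \<Sum>(shift_set x y (\<H> i0) B) < \<Sum>B"
        proof
          have "shift_set x y (\<H> i0) A \<noteq> A" using A by (auto simp: shift_set_def)
          then show "\<Sum>(shift_set x y (\<H> i0) A) < \<Sum>A"
            using sum_shift_set_le(2)[OF finA[OF i0 A(1)] A(4)] by simp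
        qed (rule A(1))
      qed (use finH[OF i0] sum_shift_set_le(1)[OF finA[OF i0] A(4)] in auto)
      ultimately show ?thesis
        unfolding M_def eq using assms(1) i0 by (intro sum_strict_mono_ex1) auto
    qed
    ultimately show False by simp
  qed
  then show ?thesis using H(1) unfolding ok_def by blast
qed

section \<open>Links of large shifted families\<close>

definition link :: "nat \<Rightarrow> nat \<Rightarrow> nat \<Rightarrow> nat set set \<Rightarrow> nat \<Rightarrow> nat set set" where
  "link s n m F j = {A \<in> nsets {s<..n} m. insert j A \<in> F}"

lemma link_antimono:
  assumes "shifted {1..n} F" "1 \<le> j" "j \<le> j'" "j' \<le> s" "s \<le> n"
  shows "link s n m F j' \<subseteq> link s n m F j"
proof
  fix A assume A: "A \<in> link s n m F j'"
  show "A \<in> link s n m F j"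
  proof (cases "j = j'")
    case False
    have sub: "A \<subseteq> {s<..n}" using A by (auto simp: link_def nsets_def)
    have "insert j (insert j' A - {j'}) \<in> F"
      using A sub assms False by (intro shiftedD[OF assms(1)]) (auto simp: link_def)
    moreover have "insert j' A - {j'} = A" using sub assms by auto
    ultimately show ?thesis using A by (simp add: link_def)
  qed (use A in simp)
qed

lemma shifted_link:
  assumes "shifted {1..n} F" "j \<le> s"
  shows "shifted {s<..n} (link s n m F j)"
  unfolding shifted_def
proof (intro ballI impI)
  fix A x y assume A: "A \<in> link s n m F j" "x \<in> A" "y \<in> {s<..n} - A" "y < x"
  have sub: "A \<subseteq> {s<..n}" "finite A" "card A = m" using A by (auto simp: link_def nsets_def)
  have "insert y (insert j A - {x}) \<in> F"
    using A sub assms(2) by (intro shiftedD[OF assms(1)]) (auto simp: link_def)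
  moreover have "insert y (insert j A - {x}) = insert j (insert y (A - {x}))" using A sub assms(2) by auto
  moreover have "insert y (A - {x}) \<in> nsets {s<..n} m"
    using A sub card_Suc_Diff1[OF sub(2) A(2)] by (auto simp: nsets_def)
  ultimately show "insert y (A - {x}) \<in> link s n m F j" by (simp add: link_def)
qed

text \<open>A family larger than that of all sets meeting \<open>{1..<s}\<close> makes up for every set it misses by a set
  avoiding \<open>{1..<s}\<close>, and the shadow bound controls the number of the latter.\<close>

lemma link_deficit:
  assumes F: "F \<subseteq> nsets {1..n} (Suc m)" "shifted {1..n} F"
    and s: "1 \<le> s" "s + c * Suc m \<le> n" "0 < c"
    and D: "(\<lambda>l. s + c * l) ` {1..Suc m} \<notin> F"
    and large: "(n choose Suc m) - ((n - s + 1) choose Suc m) < card F"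
  shows "(\<Sum>j\<in>{1..<s}. ((n - s) choose m) - card (link s n m F j)) < c * card (link s n m F s)"
proof -
  let ?k = "Suc m" and ?X = "link s n m F" and ?V = "nsets {s<..n} m"
  have sn: "s \<le> n" using s(2) by simp
  define K where "K = nsets {1..n} ?k"
  define H where "H = {A \<in> K. A \<inter> {1..<s} \<noteq> {}}"
  define G where "G = F \<inter> nsets {s<..n} ?k"
  have finK: "finite K" unfolding K_def by (simp add: finite_imp_finite_nsets)
  have finF: "finite F" using F(1) by (rule finite_subset) (simp add: finite_imp_finite_nsets)
  have finX: "finite (?X j)" for j unfolding link_def using finite_imp_finite_nsets[of "{s<..n}" m] by simp
  have KH: "K - H = nsets {s..n} ?k"
  proof -
    have "A \<subseteq> {s..n} \<longleftrightarrow> A \<subseteq> {1..n} \<and> A \<inter> {1..<s} = {}" for A using s(1) by fastforce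
    then show ?thesis unfolding K_def H_def by (auto simp: nsets_def)
  qed
  have HK: "H \<subseteq> K" unfolding H_def by auto
  have finH: "finite H" using HK finK by (rule finite_subset)
  have "card (K - H) = card K - card H" using finH HK by (rule card_Diff_subset)
  moreover have "card (K - H) = (n - s + 1) choose ?k" unfolding KH using sn by (simp add: Suc_diff_le del: binomial_Suc_Suc)
  moreover have "card K = n choose ?k" unfolding K_def by (simp add: card_nsets)
  moreover have "card H \<le> card K" using HK finK by (intro card_mono)
  ultimately have "card H < card F" using large by linarith
  moreover have "card F = card (F \<inter> H) + card (F - H)" using finF finH by (intro card_Int_Diff)
  moreover have "card H = card (H \<inter> F) + card (H - F)" using finF finH by (intro card_Int_Diff)
  ultimately have less: "card (H - F) < card (F - H)" by (simp add: Int_commute)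
  \<comment> \<open>All elements of \<open>A\<close> exceed \<open>s\<close>, so shifting
    \<open>x\<close> down to \<open>s\<close> shows that the shadow of \<open>G\<close> lies in the
    link at \<open>s\<close>.\<close>
  have shadow: "A - {x} \<in> ?X s" if A: "A \<in> G" "x \<in> A" for A x
  proof -
    have sub: "A \<in> F" "A \<subseteq> {s<..n}" "finite A" "card A = ?k" using A by (auto simp: G_def nsets_def)
    have "insert s (A - {x}) \<in> F"
      using A sub s(1) sn by (intro shiftedD[OF F(2)]) auto
    then show ?thesis using A sub by (auto simp: link_def nsets_def card_Diff_singleton)
  qed
  have "card G \<le> (c - 1) * card (?X s)"
  proof (rule card_le_shadow[where k = ?k and s = s])
    fix A assume A: "A \<in> G"
    show "finite A \<and> card A = ?k" using A by (simp add: G_def nsets_def)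
    show "\<exists>l\<in>{1..?k}. l \<le> card (A \<inter> {s<..<s + c * l})"
    proof (rule ccontr)
      assume "\<not> ?thesis"
      then have "card (A \<inter> {s<..<s + c * l}) < l" if "l \<in> {1..?k}" for l
        using that by (meson not_le)
      then have "(\<lambda>l. s + c * l) ` {1..?k} \<in> F"
        using A s F(2) by (intro progression_mem_shifted[where A = A and n = n]) (simp_all add: G_def)
      then show False using D by simp
    qed
  qed (use s(3) finX shadow finF in \<open>auto simp: G_def\<close>)
  moreover have "F - H \<subseteq> insert s ` ?X s \<union> G"
  proof
    fix A assume A: "A \<in> F - H"
    then have AK: "A \<in> nsets {s..n} ?k" using F(1) KH unfolding K_def by blast
    show "A \<in> insert s ` ?X s \<union> G"
    proof (cases "s \<in> A")
      case True
      then have "insert s (A - {s}) = A" by auto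
      moreover from this True have "A - {s} \<in> ?X s"
        using A AK by (auto simp: link_def nsets_def card_Diff_singleton order.strict_iff_order)
      ultimately show ?thesis by (metis UnI1 imageI)
    next
      case False
      then have "A \<subseteq> {s<..n}" using AK by (fastforce simp: nsets_def order.strict_iff_order)
      then show ?thesis using A AK by (auto simp: G_def nsets_def)
    qed
  qed
  then have "card (F - H) \<le> card (insert s ` ?X s \<union> G)"
    using finX finF by (intro card_mono) (auto simp: G_def)
  moreover have "card (insert s ` ?X s \<union> G) \<le> card (?X s) + card G"
    using card_Un_le[of "insert s ` ?X s" G] card_image_le[OF finX, of "insert s" s] by linarith
  \<comment> \<open>One copy of the link at \<open>s\<close> counts the sets containing
    \<open>s\<close>, the other \<open>c - 1\<close> bound the sets in \<open>G\<close>.\<close>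
  moreover have "card (?X s) + (c - 1) * card (?X s) = c * card (?X s)"
    using s(3) by (cases c) auto
  ultimately have FH: "card (F - H) \<le> c * card (?X s)" by linarith
  have "(\<Sum>j\<in>{1..<s}. ((n - s) choose m) - card (?X j)) = (\<Sum>j\<in>{1..<s}. card (insert j ` (?V - ?X j)))"
  proof (intro sum.cong refl)
    fix j assume j: "j \<in> {1..<s}"
    have "inj_on (insert j) (?V - ?X j)"
    proof (rule inj_onI)
      fix A B assume "A \<in> ?V - ?X j" "B \<in> ?V - ?X j" "insert j A = insert j B"
      moreover from this have "j \<notin> A" "j \<notin> B" using j by (auto simp: nsets_def)
      ultimately show "A = B" by (simp add: insert_ident)
    qed
    then have "card (insert j ` (?V - ?X j)) = card (?V - ?X j)" by (rule card_image)
    also have "\<dots> = card ?V - card (?X j)" using finX by (intro card_Diff_subset) (auto simp: link_def)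
    finally show "((n - s) choose m) - card (?X j) = card (insert j ` (?V - ?X j))"
      by (simp add: card_nsets)
  qed
  also have "\<dots> = card (\<Union>j\<in>{1..<s}. insert j ` (?V - ?X j))"
  proof (rule card_UN_disjoint[symmetric])
    show "\<forall>i\<in>{1..<s}. finite (insert i ` (?V - ?X i))" by (simp add: finite_imp_finite_nsets)
    show "\<forall>i\<in>{1..<s}. \<forall>j\<in>{1..<s}. i \<noteq> j \<longrightarrow> insert i ` (?V - ?X i) \<inter> insert j ` (?V - ?X j) = {}"
    proof (intro ballI impI)
      fix i j assume ij: "i \<in> {1..<s}" "j \<in> {1..<s}" "i \<noteq> j"
      have "insert i A \<noteq> insert j B" if "A \<in> ?V" "B \<in> ?V" for A B
        using that ij by (auto simp: nsets_def)
      then show "insert i ` (?V - ?X i) \<inter> insert j ` (?V - ?X j) = {}" by blast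
    qed
  qed simp
  also have "\<dots> \<le> card (H - F)"
  proof (intro card_mono)
    show "(\<Union>j\<in>{1..<s}. insert j ` (?V - ?X j)) \<subseteq> H - F"
    proof
      fix B assume "B \<in> (\<Union>j\<in>{1..<s}. insert j ` (?V - ?X j))"
      then obtain j A where jA: "j \<in> {1..<s}" "A \<in> ?V" "A \<notin> ?X j" "B = insert j A" by blast
      then have "B \<notin> F" by (auto simp: link_def)
      moreover have "j \<notin> A" using jA by (auto simp: nsets_def)
      then have "B \<in> H" using jA sn by (auto simp: H_def K_def nsets_def)
      ultimately show "B \<in> H - F" by simp
    qed
  qed (simp add: finH)
  finally show ?thesis using less FH by linarith
qed

section \<open>Rainbow matchings of large shifted families\<close>

lemma sum_power_le_geometric:
  fixes x :: real
  assumes "finite Q" "0 \<notin> Q" "0 \<le> x" "x < 1"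
  shows "(\<Sum>q\<in>Q. x ^ q) \<le> x / (1 - x)"
proof -
  have "1 + (\<Sum>q\<in>Q. x ^ q) = (\<Sum>q\<in>insert 0 Q. x ^ q)" using assms(1,2) by simp
  also have "\<dots> \<le> (\<Sum>q. x ^ q)"
    using assms by (intro sum_le_suminf) (auto simp: summable_geometric)
  also have "\<dots> = 1 / (1 - x)" using assms by (intro suminf_geometric) auto
  finally show ?thesis using assms(4) by (simp add: field_simps)
qed

lemma exp_ge_power_6:
  fixes x :: real
  assumes "0 \<le> x"
  shows "(1 + x / 6 + (x / 6)\<^sup>2 / 2) ^ 6 \<le> exp x"
proof -
  have "1 + x / 6 + (x / 6)\<^sup>2 / 2 \<le> exp (x / 6)"
    using assms by (intro exp_lower_Taylor_quadratic) auto
  then have "(1 + x / 6 + (x / 6)\<^sup>2 / 2) ^ 6 \<le> exp (x / 6) ^ 6"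
    using assms by (intro power_mono add_nonneg_nonneg) auto
  also have "\<dots> = exp x" by (simp add: exp_of_nat_mult[symmetric])
  finally show ?thesis .
qed

lemma power_one_minus_le_exp:
  fixes y :: real
  assumes "y \<le> 1" "u \<le> real T * y"
  shows "(1 - y) ^ T \<le> exp (- u)"
proof -
  have "(1 - y) ^ T \<le> exp (- y) ^ T"
    using exp_ge_add_one_self[of "- y"] assms(1) by (intro power_mono) auto
  also have "\<dots> = exp (- (real T * y))" by (simp add: exp_of_nat_mult[symmetric])
  also have "\<dots> \<le> exp (- u)" using assms(2) by simp
  finally show ?thesis .
qed

text \<open>With at least \<open>\<beta> * s\<close> blocks of density at least
  \<open>q / (7 * s)\<close> some \<open>\<beta> * q / 7\<close> hits are expected. The moment with
  \<open>z = 1/3\<close> loses \<open>3 ^ q\<close> and gains the exponential of 2/3 of that number,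
  which is \<open>exp (\<beta> * 2 / 21) ^ q\<close>.\<close>

lemma rich_tail_bound:
  fixes x b \<beta> :: real
  assumes x: "real q / (7 * real s) \<le> x" "x \<le> 1" and "0 < s" "0 < b" and b: "b \<le> exp (\<beta> * 2 / 21)"
    and that: "\<beta> * real s \<le> real T"
  shows "3 ^ q * (1 - (1 - 1/3) * x) ^ T \<le> (3 / b) ^ q"
proof -
  have "q * (\<beta> * 2 / 21) \<le> real T * ((1 - 1/3) * x)"
  proof -
    have "q * (\<beta> * 2 / 21) = (2/3) * (\<beta> * real s * (real q / (7 * real s)))"
      using assms(3) by (simp add: field_simps)
    also have "\<dots> \<le> (2/3) * (real T * (real q / (7 * real s)))"
      using that by (intro mult_left_mono mult_right_mono) auto
    also have "\<dots> \<le> (2/3) * (real T * x)" using x by (intro mult_left_mono) auto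
    finally show ?thesis by simp
  qed
  then have "(1 - (1 - 1/3) * x) ^ T \<le> exp (- (q * (\<beta> * 2 / 21)))"
    using x by (intro power_one_minus_le_exp) auto
  also have "\<dots> = (1 / exp (\<beta> * 2 / 21)) ^ q"
    by (simp only: exp_minus exp_of_nat_mult power_one_over inverse_eq_divide)
  also have "\<dots> \<le> (1 / b) ^ q" using b assms(4) by (intro power_mono divide_left_mono) auto
  finally have "3 ^ q * (1 - (1 - 1/3) * x) ^ T \<le> 3 ^ q * (1 / b) ^ q" by simp
  then show ?thesis by (simp add: power_divide)
qed

text \<open>Links shrink as \<open>j\<close> grows, so each of the \<open>s - j\<close> deficits at
  \<open>j, ..., s - 1\<close> is at least the one at \<open>j\<close>, whence
  \<open>(s - j) * (1 - x j) \<le> c * x s\<close>. This is strong when \<open>x s\<close> is tiny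
  (second claim); replacing \<open>x s\<close> by the larger \<open>x j\<close> gives a bound
  independent of \<open>x s\<close> (third claim).\<close>

lemma dens_link_props:
  assumes F: "F \<subseteq> nsets {1..n} (Suc m)" "shifted {1..n} F"
    and s: "1 \<le> s" "s + c * Suc m \<le> n" "0 < c" "m \<le> n - s"
    and D: "(\<lambda>l. s + c * l) ` {1..Suc m} \<notin> F"
    and large: "(n choose Suc m) - ((n - s + 1) choose Suc m) < card F"
  defines "x \<equiv> \<lambda>j. dens s (n - s) m (link s n m F j)"
  shows "0 < x s"
    and "\<And>j. j \<in> {1..<s} \<Longrightarrow> 1 - x j \<le> c * x s"
    and "\<And>j. j \<in> {1..<s} \<Longrightarrow> real (s - j) / (real (s - j) + c) \<le> x j"
proof -
  define C where "C = real ((n - s) choose m)"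
  have C: "C > 0" unfolding C_def using s(4) by simp
  have sn: "s + (n - s) = n" using s(2) by simp
  have x: "x j = real (card (link s n m F j)) / C" for j
  proof -
    have "link s n m F j \<inter> nsets {s<..n} m = link s n m F j" by (auto simp: link_def)
    then show ?thesis unfolding x_def dens_def sn C_def by simp
  qed
  have fin: "finite (link s n m F j)" for j
    unfolding link_def using finite_imp_finite_nsets[of "{s<..n}" m] by simp
  note less = link_deficit[OF F s(1-3) D large]
  then have "card (link s n m F s) > 0" by (cases "card (link s n m F s)") auto
  then show "0 < x s" using C by (simp add: x)
  have main: "real (s - j) * (1 - x j) \<le> c * x s" "x s \<le> x j" if j: "j \<in> {1..<s}" for j
  proof -
    have mono: "card (link s n m F j2) \<le> card (link s n m F j1)" if "1 \<le> j1" "j1 \<le> j2" "j2 \<le> s" for j1 j2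
      using link_antimono[OF F(2) that] fin sn by (intro card_mono) auto
    then show "x s \<le> x j" using j C by (auto simp: x intro!: divide_right_mono)
    have "(s - j) * (((n - s) choose m) - card (link s n m F j))
        = (\<Sum>j'\<in>{j..<s}. ((n - s) choose m) - card (link s n m F j))" by simp
    also have "\<dots> \<le> (\<Sum>j'\<in>{j..<s}. ((n - s) choose m) - card (link s n m F j'))"
      using j by (intro sum_mono diff_le_mono2 mono) auto
    also have "\<dots> \<le> (\<Sum>j'\<in>{1..<s}. ((n - s) choose m) - card (link s n m F j'))"
      using j by (intro sum_mono2) auto
    also have "\<dots> \<le> c * card (link s n m F s)" using less by simp
    finally have "real ((s - j) * (((n - s) choose m) - card (link s n m F j)))
       \<le> real (c * card (link s n m F s))" by (simp only: of_nat_le_iff)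
    then have "real (s - j) * real (((n - s) choose m) - card (link s n m F j))
       \<le> real c * real (card (link s n m F s))" by simp
    moreover have "C - real (card (link s n m F j)) \<le> real (((n - s) choose m) - card (link s n m F j))"
      unfolding C_def by linarith
    ultimately have "real (s - j) * (C - real (card (link s n m F j))) \<le> real c * real (card (link s n m F s))"
      by (meson mult_left_mono of_nat_0_le_iff order_trans)
    then have "real (s - j) * (C - real (card (link s n m F j))) / C \<le> real c * real (card (link s n m F s)) / C"
      using C by (intro divide_right_mono) auto
    then show "real (s - j) * (1 - x j) \<le> c * x s"
      using C by (simp add: x diff_divide_distrib right_diff_distrib)
  qed
  show "1 - x j \<le> c * x s" if j: "j \<in> {1..<s}" for j
  proof -
    have "1 - x j \<ge> 0" unfolding x_def using dens_le_1 by simp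
    moreover have "1 \<le> real (s - j)" using j by simp
    ultimately have "1 - x j \<le> real (s - j) * (1 - x j)" by (metis mult_1 mult_right_mono)
    then show ?thesis using main(1)[OF j] by simp
  qed
  show "real (s - j) / (real (s - j) + c) \<le> x j" if j: "j \<in> {1..<s}" for j
  proof -
    have "c * x s \<le> c * x j" using main(2)[OF j] by (intro mult_left_mono) auto
    then have "real (s - j) \<le> (real (s - j) + c) * x j" using main(1)[OF j] by (simp add: algebra_simps)
    moreover have "real (s - j) + c > 0" using j by simp
    ultimately show ?thesis by (simp add: divide_le_eq mult.commute)
  qed
qed

text \<open>Each family completes a block of its own by its own element \<open>j i\<close>. The
  inclusion for \<open>C i\<close> serves to keep these sets apart from a reserved part of the
  ground set.\<close>

lemma exists_rainbow_from_blocks: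
  assumes "finite P" "inj_on j P" "j ` P \<subseteq> {1..s}" "inj_on r P"
    and A: "\<And>t. t \<in> I \<Longrightarrow> A t \<subseteq> {s<..n}" "disjoint_family_on A I"
    and hits: "\<And>i. i \<in> P \<Longrightarrow> 1 \<le> r i \<and> r i \<le> card {t \<in> I. A t \<in> link s n m (\<F> i) (j i)}"
  shows "\<exists>C. (\<forall>i\<in>P. C i \<in> \<F> i \<and> C i \<subseteq> {1..s} \<union> (\<Union>t\<in>I. A t)) \<and> disjoint_family_on C P"
proof -
  obtain f where f: "inj_on f P" "\<And>i. i \<in> P \<Longrightarrow> f i \<in> {t \<in> I. A t \<in> link s n m (\<F> i) (j i)}"
    using exists_distinct_representatives[OF assms(1,4) hits] by blast
  define C where "C i = insert (j i) (A (f i))" for i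
  have "C i \<in> \<F> i \<and> C i \<subseteq> {1..s} \<union> (\<Union>t\<in>I. A t)" if "i \<in> P" for i
    using f(2)[OF that] assms(3) that by (auto simp: C_def link_def)
  moreover have "disjoint_family_on C P"
    unfolding disjoint_family_on_def
  proof (intro ballI impI)
    fix i i' assume i: "i \<in> P" "i' \<in> P" "i \<noteq> i'"
    have "f i \<noteq> f i'" "j i \<noteq> j i'" using i f(1) assms(2) by (auto simp: inj_on_def)
    moreover from this have "A (f i) \<inter> A (f i') = {}"
      using f(2)[OF i(1)] f(2)[OF i(2)] A(2) by (auto simp: disjoint_family_on_def)
    moreover have "j i \<notin> A (f u)" "j i' \<notin> A (f u)" if "u \<in> P" for u
      using A(1)[of "f u"] f(2)[OF that] assms(3) i by fastforce+
    ultimately show "C i \<inter> C i' = {}" using i unfolding C_def by auto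
  qed
  ultimately show ?thesis by blast
qed

text \<open>The three numerical bounds fix the ratios of the geometric series:
  \<open>3 / 12 = 1/4\<close> for \<open>31 * s\<close> blocks, \<open>3 / (9/2) = 2/3\<close> for
  \<open>16 * s\<close> blocks, and \<open>3 / (20/3) = 9/20\<close> for the reserved
  singletons.\<close>

lemma exp_62_21_ge: "12 \<le> exp (31 * 2 / 21 :: real)"
  by (rule order_trans[OF _ exp_ge_power_6]) (simp_all add: power_divide)

lemma exp_32_21_ge: "9 / 2 \<le> exp (16 * 2 / 21 :: real)"
  by (rule order_trans[OF _ exp_ge_power_6]) (simp_all add: power_divide)

lemma exp_60_31_ge: "20 / 3 \<le> exp (60 / 31 :: real)"
  by (rule order_trans[OF _ exp_ge_power_6]) (simp_all add: power_divide)

text \<open>Of the \<open>31 * s\<close> factors \<open>2 * \<eta>\<close>, \<open>q\<close> cancel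
  the powers of \<open>1 / \<eta>\<close>, one is kept to supply \<open>\<eta>\<close>, and the
  remaining ones, at least \<open>30 * s\<close>, are at most 1/2 each and absorb the powers of 2
  and the factor \<open>s\<close>.\<close>

lemma tiny_tail_bound:
  fixes \<eta> :: real
  assumes "0 < \<eta>" "\<eta> \<le> 1/4" "q < s"
  shows "(1 / \<eta>) ^ q * (2 * \<eta>) ^ (31 * s) \<le> \<eta> / s"
proof -
  define d where "d = 31 * s - q - 1"
  have d: "31 * s = q + Suc d" "30 * s \<le> d" using assms(3) by (auto simp: d_def)
  have "(1 / \<eta>) ^ q * (2 * \<eta>) ^ (31 * s) = ((1 / \<eta>) * (2 * \<eta>)) ^ q * ((2 * \<eta>) * (2 * \<eta>) ^ d)"
    unfolding d(1) power_add power_mult_distrib by simp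
  also have "\<dots> = 2 ^ q * (2 * \<eta>) * (2 * \<eta>) ^ d" using assms(1) by simp
  also have "\<dots> \<le> 2 ^ q * (2 * \<eta>) * (1 / 2) ^ d"
    using assms by (intro mult_left_mono power_mono) auto
  also have "\<dots> \<le> 2 ^ q * (2 * \<eta>) * (1 / 2) ^ (30 * s)"
    using assms d(2) by (intro mult_left_mono power_decreasing) auto
  also have "\<dots> = \<eta> * 2 ^ Suc q * (1 / 2) ^ (30 * s)" by simp
  also have "\<dots> \<le> \<eta> * 2 ^ s * (1 / 2) ^ (30 * s)"
    using assms by (intro mult_right_mono mult_left_mono power_increasing) auto
  also have "\<dots> \<le> \<eta> * 2 ^ s * (1 / 2) ^ (2 * s)"
    using assms by (intro mult_left_mono power_decreasing) auto
  also have "\<dots> = \<eta> * (1 / 2) ^ s"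
    unfolding mult_2 power_add by (simp add: power_mult_distrib[symmetric])
  also have "\<dots> = \<eta> / 2 ^ s" by (simp add: power_divide)
  also have "\<dots> \<le> \<eta> / s"
    using assms less_exp[of s] by (intro divide_left_mono) (auto simp: of_nat_le_numeral_power_cancel_iff)
  finally show ?thesis .
qed

text \<open>With \<open>c = 6 * s\<close> the denominator is at most \<open>7 * s\<close>, the
  origin of the 7 in the tail bounds.\<close>

lemma dens_link_rich:
  assumes "\<And>j. j \<in> {1..<s} \<Longrightarrow> real (s - j) / (real (s - j) + real (6 * s)) \<le> x j" "j \<in> {1..<s}"
  shows "real (s - j) / (7 * real s) \<le> x j"
proof -
  have "real (s - j) / (7 * real s) \<le> real (s - j) / (real (s - j) + real (6 * s))"
    using assms(2) by (intro divide_left_mono) auto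
  then show ?thesis using assms(1)[OF assms(2)] by simp
qed

lemma sum_inj_power_le:
  fixes x :: real and q :: "'i \<Rightarrow> nat"
  assumes "finite P" "inj_on q P" "\<And>i. i \<in> P \<Longrightarrow> q i \<noteq> 0" "0 \<le> x" "x < 1"
  shows "(\<Sum>i\<in>P. x ^ q i) \<le> x / (1 - x)"
proof -
  have "(\<Sum>i\<in>P. x ^ q i) = (\<Sum>u\<in>q ` P. x ^ u)" using assms(2) by (simp add: sum.reindex)
  also have "\<dots> \<le> x / (1 - x)"
  proof (rule sum_power_le_geometric)
    show "0 \<notin> q ` P" using assms(3) by force
  qed (use assms in auto)
  finally show ?thesis .
qed

text \<open>Here a family matched to \<open>s\<close> may have a tiny link, so the family with the largest link at \<open>s\<close> is
  chosen for it; if even this link is tiny, all other links are almost complete.\<close>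

lemma rainbow_without_progressions:
  fixes \<F> :: "nat \<Rightarrow> nat set set"
  assumes s: "2 \<le> s" and n: "32 * (s * Suc m) \<le> n"
    and F: "\<And>i. i \<in> {1..s} \<Longrightarrow> \<F> i \<subseteq> nsets {1..n} (Suc m)"
      "\<And>i. i \<in> {1..s} \<Longrightarrow> shifted {1..n} (\<F> i)"
    and large: "\<And>i. i \<in> {1..s} \<Longrightarrow> (n choose Suc m) - ((n - s + 1) choose Suc m) < card (\<F> i)"
    and D: "\<And>i. i \<in> {1..s} \<Longrightarrow> (\<lambda>l. s + (6 * s) * l) ` {1..Suc m} \<notin> \<F> i"
  shows "\<exists>C. (\<forall>i\<in>{1..s}. C i \<in> \<F> i) \<and> disjoint_family_on C {1..s}"
proof -
  have sp: "s + 6 * s * Suc m \<le> n" "31 * s * m \<le> n - s" "s \<le> n" "m \<le> n - s"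
  proof -
    have "32 * (s * m) + 32 * s \<le> n" using n by simp
    then show "s + 6 * s * Suc m \<le> n" "31 * s * m \<le> n - s" "s \<le> n" by (simp_all add: algebra_simps)
    have "m \<le> s * m" using s by simp
    then show "m \<le> n - s" using \<open>32 * (s * m) + 32 * s \<le> n\<close> by linarith
  qed
  have V: "{s<..s + (n - s)} = {s<..n}" using sp(3) by simp
  define x where "x i j = dens s (n - s) m (link s n m (\<F> i) j)" for i j
  have c0: "1 \<le> s" "0 < 6 * s" using s by auto
  note props = dens_link_props[OF F c0(1) sp(1) c0(2) sp(4) D large, folded x_def]
  have x1: "x i j \<le> 1" "0 \<le> x i j" for i j unfolding x_def by (auto intro: dens_le_1 dens_nonneg)
  have "Max ((\<lambda>i. x i s) ` {1..s}) \<in> (\<lambda>i. x i s) ` {1..s}" using s by (intro Max_in) auto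
  then obtain i0 where i0: "i0 \<in> {1..s}" "x i0 s = Max ((\<lambda>i. x i s) ` {1..s})" by force
  have max: "x i s \<le> x i0 s" if "i \<in> {1..s}" for i unfolding i0(2) using that by (intro Max_ge) auto
  \<comment> \<open>The identity with \<open>s\<close> and \<open>i0\<close> interchanged, so that
    \<open>s\<close> goes to the family with the densest link there.\<close>
  define j where "j i = (if i = i0 then s else if i = s then i0 else i)" for i
  have j_inj: "inj_on j {1..s}" using i0(1) by (auto simp: inj_on_def j_def split: if_splits)
  have j_le: "j ` {1..s} \<subseteq> {1..s}" using i0(1) by (auto simp: j_def)
  have j_less: "j i \<in> {1..<s}" if "i \<in> {1..s} - {i0}" for i using that i0(1) by (auto simp: j_def)
  have j0: "j i0 = s" by (simp add: j_def)
  have q_inj: "inj_on (\<lambda>i. s - j i) {1..s}"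
    using j_inj j_le unfolding inj_on_def image_subset_iff by (metis atLeastAtMost_iff diff_diff_cancel)
  \<comment> \<open>The greedy choice asks for \<open>s - j i + 1\<close> hits, so
    \<open>f z i\<close> bounds the event of at most \<open>s - j i\<close> hits among
    \<open>31 * s\<close> blocks.\<close>
  define f where "f z i = (1 / z) ^ (s - j i) * (1 - (1 - z) * x i (j i)) ^ (31 * s)" for z :: real and i
  have "\<exists>z. 0 < z \<and> z \<le> 1 \<and> (\<Sum>i\<in>{1..s}. f z i) < 1"
  proof (cases "1 / 4 \<le> 6 * s * x i0 s")
    case True
    define z :: real where "z = 1 / 3"
    have "f z i \<le> (1 / 4) ^ (s - j i)" if i: "i \<in> {1..s} - {i0}" for i
    proof -
      have "real (s - j i) / (7 * real s) \<le> x i (j i)"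
        using props(3) i by (intro dens_link_rich[OF _ j_less[OF i]]) auto
      then have "3 ^ (s - j i) * (1 - (1 - 1 / 3) * x i (j i)) ^ (31 * s) \<le> (3 / 12) ^ (s - j i)"
        using s x1 exp_62_21_ge by (intro rich_tail_bound[where \<beta> = 31 and s = s]) auto
      then show ?thesis unfolding f_def z_def by simp
    qed
    then have "(\<Sum>i\<in>{1..s} - {i0}. f z i) \<le> (\<Sum>i\<in>{1..s} - {i0}. (1 / 4) ^ (s - j i))" by (rule sum_mono)
    also have "\<dots> \<le> (1 / 4) / (1 - 1 / 4)"
      using inj_on_subset[OF q_inj] j_less by (intro sum_inj_power_le) force+
    finally have 1: "(\<Sum>i\<in>{1..s} - {i0}. f z i) \<le> 1 / 3" by simp
    \<comment> \<open>A single hit is required at \<open>s\<close>. The case assumption gives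
      density at least \<open>1 / (24 * s)\<close>, and
      \<open>31 * s * (2/3) / (24 * s) = 31/36\<close>; the total is then at most 1/3 +
      36/67.\<close>
    have "(1 - (1 - 1 / 3) * x i0 s) ^ (31 * s) \<le> exp (- (31 / 36))"
      using True x1[of i0 s] by (intro power_one_minus_le_exp) auto
    also have "\<dots> = 1 / exp (31 / 36)" by (simp add: exp_minus inverse_eq_divide)
    also have "\<dots> \<le> 1 / (1 + 31 / 36)"
      by (intro divide_left_mono exp_ge_add_one_self) auto
    finally have "f z i0 \<le> 36 / 67" unfolding f_def z_def j0 by simp
    moreover have "(\<Sum>i\<in>{1..s}. f z i) = f z i0 + (\<Sum>i\<in>{1..s} - {i0}. f z i)"
      using i0(1) by (intro sum.remove) auto
    ultimately have "(\<Sum>i\<in>{1..s}. f z i) < 1" using 1 by simp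
    then show ?thesis by (intro exI[of _ z]) (simp add: z_def)
  next
    case False
    \<comment> \<open>\<open>\<eta>\<close> bounds the deficits of all links used at
      \<open>j < s\<close>, and is also taken as \<open>z\<close>. The other families then fail with
      total bound \<open>\<eta>\<close>, while \<open>i0\<close> gains about
      \<open>3 * \<eta>\<close>, however small \<open>\<eta>\<close> is.\<close>
    define \<eta> where "\<eta> = 6 * s * x i0 s"
    have \<eta>: "0 < \<eta>" "\<eta> < 1 / 4" using False props(1)[OF i0(1) i0(1) i0(1) i0(1)] s by (auto simp: \<eta>_def)
    have "f \<eta> i \<le> \<eta> / s" if i: "i \<in> {1..s} - {i0}" for i
    proof -
      have i': "i \<in> {1..s}" using i by simp
      have "1 - x i (j i) \<le> real (6 * s) * x i s" using props(2)[OF i' i' i' i' j_less[OF i]] .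
      also have "\<dots> \<le> \<eta>" unfolding \<eta>_def using max[OF i'] s by simp
      finally have "1 - \<eta> \<le> x i (j i)" by simp
      then have "(1 - \<eta>) * (1 - \<eta>) \<le> (1 - \<eta>) * x i (j i)" using \<eta> by (intro mult_left_mono) auto
      moreover have "0 \<le> \<eta> * \<eta>" by simp
      moreover have "(1 - \<eta>) * (1 - \<eta>) = 1 - 2 * \<eta> + \<eta> * \<eta>" by (simp add: algebra_simps)
      ultimately have "1 - (1 - \<eta>) * x i (j i) \<le> 2 * \<eta>" by linarith
      moreover have "0 \<le> 1 - (1 - \<eta>) * x i (j i)"
        using \<eta> x1[of i "j i"] mult_mono[of "1 - \<eta>" 1 "x i (j i)" 1] by simp
      ultimately have "f \<eta> i \<le> (1 / \<eta>) ^ (s - j i) * (2 * \<eta>) ^ (31 * s)"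
        unfolding f_def using \<eta> by (intro mult_left_mono power_mono) auto
      also have "\<dots> \<le> \<eta> / s" using \<eta> j_less[OF i] by (intro tiny_tail_bound) auto
      finally show ?thesis .
    qed
    then have "(\<Sum>i\<in>{1..s} - {i0}. f \<eta> i) \<le> (\<Sum>i\<in>{1..s} - {i0}. \<eta> / s)" by (rule sum_mono)
    also have "\<dots> = real (s - 1) * \<eta> / s" using i0(1) by simp
    also have "\<dots> \<le> \<eta>" using \<eta> s by (simp add: field_simps)
    finally have 1: "(\<Sum>i\<in>{1..s} - {i0}. f \<eta> i) \<le> \<eta>" .
    \<comment> \<open>By definition \<open>31 * s * x i0 s = 31/6 * \<eta>\<close>, and
      \<open>3/4 * 31/6\<close> exceeds 3.\<close>
    have "3 * \<eta> \<le> (1 - \<eta>) * (31 / 6 * \<eta>)"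
    proof -
      have "(3 / 4) * (31 / 6 * \<eta>) \<le> (1 - \<eta>) * (31 / 6 * \<eta>)" using \<eta> by (intro mult_right_mono) auto
      then show ?thesis using \<eta> by simp
    qed
    also have "\<dots> = real (31 * s) * ((1 - \<eta>) * x i0 s)" unfolding \<eta>_def by simp
    finally have "(1 - (1 - \<eta>) * x i0 s) ^ (31 * s) \<le> exp (- (3 * \<eta>))"
      using \<eta> x1[of i0 s] mult_mono[of "1 - \<eta>" 1 "x i0 s" 1] by (intro power_one_minus_le_exp) auto
    also have "\<dots> = 1 / exp (3 * \<eta>)" by (simp add: exp_minus inverse_eq_divide)
    also have "\<dots> \<le> 1 / (1 + 3 * \<eta>)"
      using \<eta> by (intro divide_left_mono exp_ge_add_one_self) auto
    finally have "f \<eta> i0 \<le> 1 / (1 + 3 * \<eta>)" unfolding f_def j0 by simp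
    moreover have "1 / (1 + 3 * \<eta>) + \<eta> < 1"
    proof -
      have "\<eta> * (3 * \<eta>) < \<eta> * 2" using \<eta> by (intro mult_strict_left_mono) auto
      then have "1 + \<eta> * (1 + 3 * \<eta>) < 1 + 3 * \<eta>" by (simp add: algebra_simps)
      then show ?thesis using \<eta> by (simp add: field_simps)
    qed
    moreover have "(\<Sum>i\<in>{1..s}. f \<eta> i) = f \<eta> i0 + (\<Sum>i\<in>{1..s} - {i0}. f \<eta> i)"
      using i0(1) by (intro sum.remove) auto
    ultimately have "(\<Sum>i\<in>{1..s}. f \<eta> i) < 1" using 1 by linarith
    then show ?thesis using \<eta> by (intro exI[of _ \<eta>]) simp
  qed
  then obtain z where z: "0 < z" "z \<le> 1" "(\<Sum>i\<in>{1..s}. f z i) < 1" by blast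
  have "\<exists>A. (\<forall>t\<in>{..<31 * s}. A t \<in> nsets {s<..s + (n - s)} m) \<and> disjoint_family_on A {..<31 * s} \<and>
    (\<forall>i\<in>{1..s}. s - j i < card {t \<in> {..<31 * s}. A t \<in> link s n m (\<F> i) (j i)})"
  proof (rule exists_blocks_many_hits[OF _ _ _ z(1,2)])
    show "(\<Sum>t\<in>{..<31 * s}. m) \<le> n - s" using sp(2) by simp
    show "shifted {s<..s + (n - s)} (link s n m (\<F> i) (j i))" if "i \<in> {1..s}" for i
    proof -
      have "j i \<le> s" using j_le that by (simp add: image_subset_iff)
      then show ?thesis unfolding V using F(2)[OF that] by (intro shifted_link)
    qed
    show "(\<Sum>i\<in>{1..s}. (1 / z) ^ (s - j i) *
      (\<Prod>t\<in>{..<31 * s}. 1 - (1 - z) * dens s (n - s) m (link s n m (\<F> i) (j i)))) < 1"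
      using z(3) unfolding f_def x_def by simp
  qed auto
  then obtain A where A: "\<And>t. t \<in> {..<31 * s} \<Longrightarrow> A t \<in> nsets {s<..n} m"
    "disjoint_family_on A {..<31 * s}"
    "\<And>i. i \<in> {1..s} \<Longrightarrow> s - j i < card {t \<in> {..<31 * s}. A t \<in> link s n m (\<F> i) (j i)}"
    unfolding V by blast
  have "\<exists>C. (\<forall>i\<in>{1..s}. C i \<in> \<F> i \<and> C i \<subseteq> {1..s} \<union> (\<Union>t\<in>{..<31 * s}. A t)) \<and>
    disjoint_family_on C {1..s}"
  proof (rule exists_rainbow_from_blocks[OF _ j_inj j_le _ _ A(2)])
    show "inj_on (\<lambda>i. Suc (s - j i)) {1..s}"
      using comp_inj_on[OF q_inj inj_Suc] by (simp add: comp_def)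
    show "A t \<subseteq> {s<..n}" if "t \<in> {..<31 * s}" for t using A(1)[OF that] by (simp add: nsets_def)
    show "1 \<le> Suc (s - j i) \<and> Suc (s - j i) \<le> card {t \<in> {..<31 * s}. A t \<in> link s n m (\<F> i) (j i)}"
      if "i \<in> {1..s}" for i using A(3)[OF that] by simp
  qed auto
  then show ?thesis by blast
qed

lemma shifted_empty: "shifted V {}"
  by (simp add: shifted_def)

lemma shifted_initial_singletons: "shifted {a<..b} ((\<lambda>x. {x}) ` {a<..c})"
  by (auto simp: shifted_def)

lemma dens_empty: "dens a N m {} = 0"
  by (simp add: dens_def)

lemma dens_initial_singletons:
  assumes "c \<le> N"
  shows "dens a N 1 ((\<lambda>x. {x}) ` {a<..a + c}) = real c / real N"
proof -
  have "(\<lambda>x. {x}) ` {a<..a + c} \<inter> nsets {a<..a + N} 1 = (\<lambda>x. {x}) ` {a<..a + c}"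
    using assms by (auto simp: nsets_def)
  then show ?thesis by (simp add: dens_def card_image)
qed

text \<open>The exponential moment at \<open>z = 1/3\<close> gives \<open>(9/20) ^ (s * l)\<close>,
  and \<open>s \<ge> 2\<close> turns this into \<open>(1/4) ^ l\<close> since
  \<open>(9/20)^2 < 1/4\<close>. The factor 1/3 comes from the exponent
  \<open>s * l - 1\<close>.\<close>

lemma early_tail_bound:
  fixes d :: real
  assumes "2 \<le> s" "1 \<le> l" "d \<le> 1" "60 / 31 * real (s * l) \<le> real T * ((1 - 1 / 3) * d)"
  shows "3 ^ (s * l - 1) * (1 - (1 - 1 / 3) * d) ^ T \<le> 1 / 3 * (1 / 4) ^ l"
proof -
  have "(1 - (1 - 1 / 3) * d) ^ T \<le> exp (- (real (s * l) * (60 / 31)))"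
    using assms by (intro power_one_minus_le_exp) auto
  also have "\<dots> = (1 / exp (60 / 31)) ^ (s * l)"
    by (simp only: exp_minus exp_of_nat_mult power_one_over inverse_eq_divide)
  also have "\<dots> \<le> (1 / (20 / 3)) ^ (s * l)"
    using exp_60_31_ge by (intro power_mono divide_left_mono) auto
  finally have "3 ^ (s * l) * (1 - (1 - 1 / 3) * d) ^ T \<le> 3 ^ (s * l) * (1 / (20 / 3)) ^ (s * l)"
    by (intro mult_left_mono) auto
  also have "\<dots> = ((9 / 20) ^ s) ^ l"
    unfolding power_mult_distrib[symmetric] by (simp add: power_mult)
  also have "\<dots> \<le> (1 / 4) ^ l"
  proof (rule power_mono)
    have "(9 / 20 :: real) ^ s \<le> (9 / 20) ^ 2" using assms(1) by (intro power_decreasing) auto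
    then show "(9 / 20 :: real) ^ s \<le> 1 / 4" by (simp add: power2_eq_square)
  qed simp
  finally have *: "3 ^ (s * l) * (1 - (1 - 1 / 3) * d) ^ T \<le> (1 / 4) ^ l" .
  have "s * l \<noteq> 0" using assms by simp
  then have "(3::real) ^ (s * l) = 3 * 3 ^ (s * l - 1)" by (metis power_minus_mult mult.commute neq0_conv)
  then show ?thesis using * by simp
qed

text \<open>A family containing the progression contains every \<open>k\<close>-set below it in the shifting order. About
  half of the ground set, split into random singletons \<open>R\<close>, is reserved for these families; the others
  are matched to \<open>{1..<s}\<close> and to random blocks of size \<open>m\<close>.\<close>

lemma rainbow_with_progression:
  fixes \<F> :: "nat \<Rightarrow> nat set set"
  assumes s: "2 \<le> s" and n: "32 * (s * Suc m) \<le> n"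
    and F: "\<And>i. i \<in> {1..s} \<Longrightarrow> \<F> i \<subseteq> nsets {1..n} (Suc m)"
      "\<And>i. i \<in> {1..s} \<Longrightarrow> shifted {1..n} (\<F> i)"
    and large: "\<And>i. i \<in> {1..s} \<Longrightarrow> (n choose Suc m) - ((n - s + 1) choose Suc m) < card (\<F> i)"
    and D: "i1 \<in> {1..s}" "(\<lambda>l. s + (6 * s) * l) ` {1..Suc m} \<in> \<F> i1"
  shows "\<exists>C. (\<forall>i\<in>{1..s}. C i \<in> \<F> i) \<and> disjoint_family_on C {1..s}"
proof -
  define N where "N = n - s"
  have sp: "s + 6 * s * Suc m \<le> n" "31 * (s * m) + 31 * s \<le> N" "s \<le> n" "m \<le> N"
  proof -
    have *: "32 * (s * m) + 32 * s \<le> n" using n by simp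
    then show "s + 6 * s * Suc m \<le> n" "31 * (s * m) + 31 * s \<le> N" "s \<le> n"
      by (simp_all add: N_def algebra_simps)
    have "m \<le> s * m" using s by simp
    then show "m \<le> N" using * unfolding N_def by linarith
  qed
  have V: "{s<..s + N} = {s<..n}" using sp(3) by (simp add: N_def)
  \<comment> \<open>Since \<open>i1\<close> is outside \<open>P\<close>, at most
    \<open>s - 1\<close> families need an element \<open>j\<close>, and the possibly thin link at
    \<open>s\<close> is avoided.\<close>
  define P where "P = {i \<in> {1..s}. (\<lambda>l. s + (6 * s) * l) ` {1..Suc m} \<notin> \<F> i}"
  define Q where "Q = {1..s} - P"
  have PD: "i \<in> {1..s}" "(\<lambda>l. s + (6 * s) * l) ` {1..Suc m} \<notin> \<F> i" if "i \<in> P" for i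
    using that by (auto simp: P_def)
  have finP: "finite P" by (simp add: P_def)
  have "P \<subseteq> {1..s} - {i1}" using D(2) by (auto simp: P_def)
  then have "card P \<le> card ({1..s} - {i1})" by (intro card_mono) auto
  then have "card P \<le> card {1..<s}" using D(1) by simp
  then obtain j where j: "j ` P \<subseteq> {1..<s}" "inj_on j P" using card_le_inj[OF finP, of "{1..<s}"] by auto
  have j_less: "j i \<in> {1..<s}" if "i \<in> P" for i using j(1) that by auto
  have q_inj: "inj_on (\<lambda>i. s - j i) P"
    using j j_less unfolding inj_on_def
    by (metis atLeastLessThan_iff diff_diff_cancel less_imp_le)
  \<comment> \<open>The \<open>16 * s\<close> blocks of size \<open>m\<close> take at most 16/31 of
    the \<open>N\<close> elements, leaving at least 15/31 for singletons.\<close>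
  define T where "T = 16 * s"
  define \<rho> where "\<rho> = N - T * m"
  define I where "I = {..<T + \<rho>}"
  define sz where "sz t = (if t < T then m else 1)" for t
  \<comment> \<open>Tests \<open>Inl i\<close> ask for \<open>s - j i\<close> hits, which is already
    positive and serves as rank; tests \<open>Inr l\<close> ask for \<open>s * l\<close> singletons
    up to \<open>s + 6 * s * l\<close>. As hits must exceed \<open>q\<close>, 1 is subtracted; the
    factor 1/3 gained thereby brings the total below 1.\<close>
  define q where "q = case_sum (\<lambda>i. s - j i - 1) (\<lambda>l. s * l - 1)"
  define S where "S l = (\<lambda>x. {x}) ` {s<..s + 6 * s * l}" for l
  \<comment> \<open>A block of the wrong kind is tested against the empty family, so its density is
    0 and its factor 1.\<close>
  define G where "G = case_sum (\<lambda>i t. if t < T then link s n m (\<F> i) (j i) else {})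
    (\<lambda>l t. if t < T then {} else S l)"
  define x where "x i = dens s N m (link s n m (\<F> i) (j i))" for i
  have I: "I = {..<T} \<union> {T..<T + \<rho>}" "{..<T} \<inter> {T..<T + \<rho>} = {}" by (auto simp: I_def)
  have TmN: "T * m \<le> N" using sp(2) by (simp add: T_def)
  have sz: "(\<Sum>t\<in>I. sz t) \<le> N"
  proof -
    have "(\<Sum>t\<in>I. sz t) = (\<Sum>t\<in>{..<T}. sz t) + (\<Sum>t\<in>{T..<T + \<rho>}. sz t)"
      unfolding I(1) by (intro sum.union_disjoint I) auto
    also have "\<dots> = T * m + \<rho>" by (simp add: sz_def)
    finally show ?thesis using TmN by (simp add: \<rho>_def)
  qed
  have prod_I: "(\<Prod>t\<in>I. 1 - (1 - 1 / 3) * dens s N (sz t) (if t < T then L else M))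
      = (1 - (1 - 1 / 3) * dens s N m L) ^ T * (1 - (1 - 1 / 3) * dens s N 1 M) ^ \<rho>" for L M
  proof -
    let ?g = "\<lambda>t. 1 - (1 - 1 / 3) * dens s N (sz t) (if t < T then L else M)"
    have "(\<Prod>t\<in>I. ?g t) = (\<Prod>t\<in>{..<T}. ?g t) * (\<Prod>t\<in>{T..<T + \<rho>}. ?g t)"
      unfolding I(1) by (intro prod.union_disjoint I) auto
    then show ?thesis by (simp add: sz_def)
  qed
  have rho: "15 / 31 * real N \<le> real \<rho>"
  proof -
    have "real \<rho> = real N - 16 * real (s * m)" using TmN by (simp add: \<rho>_def T_def of_nat_diff)
    moreover have "31 * real (s * m) \<le> real N" using sp(2) by linarith
    ultimately show ?thesis by linarith
  qed
  have c0: "1 \<le> s" "0 < 6 * s" using s by auto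
  have N0: "0 < N" using sp(2) s by linarith
  have P_test: "3 ^ (s - j i - 1) * (1 - (1 - 1 / 3) * x i) ^ T \<le> 1 / 3 * (2 / 3) ^ (s - j i)"
    if i: "i \<in> P" for i
  proof -
    have "real (s - j i) / (7 * real s) \<le> x i"
      unfolding x_def N_def
      using dens_link_props(3)[OF F(1) F(2) c0(1) sp(1) c0(2) sp(4)[unfolded N_def] PD(2)[OF i] large] PD(1)[OF i]
      by (intro dens_link_rich[OF _ j_less[OF i]]) auto
    then have "3 ^ (s - j i) * (1 - (1 - 1 / 3) * x i) ^ T \<le> (3 / (9 / 2)) ^ (s - j i)"
      using s exp_32_21_ge
      by (intro rich_tail_bound[where \<beta> = 16 and s = s]) (auto simp: x_def dens_le_1 T_def)
    moreover have "(3::real) ^ (s - j i) = 3 * 3 ^ (s - j i - 1)"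
      using j_less[OF i] by (metis power_minus_mult mult.commute atLeastLessThan_iff zero_less_diff)
    ultimately show ?thesis by simp
  qed
  have S_test: "3 ^ (s * l - 1) * (1 - (1 - 1 / 3) * dens s N 1 (S l)) ^ \<rho> \<le> 1 / 3 * (1 / 4) ^ l"
    if l: "l \<in> {1..Suc m}" for l
  proof -
    have "6 * s * l \<le> 6 * s * Suc m" using l by (intro mult_left_mono) auto
    then have "6 * s * l \<le> N" using sp(1) unfolding N_def by linarith
    then have d: "dens s N 1 (S l) = real (6 * s * l) / real N"
      unfolding S_def by (rule dens_initial_singletons)
    show ?thesis
    proof (rule early_tail_bound[OF s])
      \<comment> \<open>The constant is \<open>15/31 * 2/3 * 6\<close>: the share of singletons,
        \<open>1 - z\<close>, and \<open>c / s\<close>.\<close>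
      have "60 / 31 * real (s * l) = (15 / 31 * real N) * ((1 - 1 / 3) * (real (6 * s * l) / real N))"
        using N0 by (simp add: field_simps)
      also have "\<dots> \<le> real \<rho> * ((1 - 1 / 3) * (real (6 * s * l) / real N))"
        using rho by (intro mult_right_mono) auto
      finally show "60 / 31 * real (s * l) \<le> real \<rho> * ((1 - 1 / 3) * dens s N 1 (S l))" unfolding d .
    qed (use l dens_le_1 in auto)
  qed
  have total: "(\<Sum>e\<in>P <+> {1..Suc m}. (1 / (1 / 3)) ^ q e *
    (\<Prod>t\<in>I. 1 - (1 - 1 / 3) * dens s N (sz t) (G e t))) < 1"
  proof -
    have "(\<Sum>e\<in>P <+> {1..Suc m}. (1 / (1 / 3)) ^ q e * (\<Prod>t\<in>I. 1 - (1 - 1 / 3) * dens s N (sz t) (G e t)))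
      = (\<Sum>i\<in>P. 3 ^ (s - j i - 1) * (1 - (1 - 1 / 3) * x i) ^ T)
        + (\<Sum>l\<in>{1..Suc m}. 3 ^ (s * l - 1) * (1 - (1 - 1 / 3) * dens s N 1 (S l)) ^ \<rho>)"
      using finP by (simp only: sum.Plus finite_atLeastAtMost o_def q_def G_def sum.case prod_I dens_empty x_def) simp
    also have "\<dots> \<le> (\<Sum>i\<in>P. 1 / 3 * (2 / 3) ^ (s - j i)) + (\<Sum>l\<in>{1..Suc m}. 1 / 3 * (1 / 4) ^ l)"
      by (intro add_mono sum_mono P_test S_test)
    also have "\<dots> = 1 / 3 * (\<Sum>i\<in>P. (2 / 3) ^ (s - j i)) + 1 / 3 * (\<Sum>l\<in>{1..Suc m}. (1 / 4) ^ l)"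
      by (simp only: sum_distrib_left)
    \<comment> \<open>The two series contribute 2/3 and 1/9.\<close>
    also have "\<dots> \<le> 1 / 3 * ((2 / 3) / (1 - 2 / 3)) + 1 / 3 * ((1 / 4) / (1 - 1 / 4))"
    proof (intro add_mono mult_left_mono)
      show "(\<Sum>i\<in>P. (2 / 3 :: real) ^ (s - j i)) \<le> (2 / 3) / (1 - 2 / 3)"
        using finP q_inj j_less by (intro sum_inj_power_le) force+
      show "(\<Sum>l\<in>{1..Suc m}. (1 / 4 :: real) ^ l) \<le> (1 / 4) / (1 - 1 / 4)"
        by (rule sum_power_le_geometric) auto
    qed auto
    also have "\<dots> < 1" by simp
    finally show ?thesis .
  qed
  have "\<exists>A. (\<forall>t\<in>I. A t \<in> nsets {s<..s + N} (sz t)) \<and> disjoint_family_on A I \<and>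
    (\<forall>e\<in>P <+> {1..Suc m}. q e < card {t \<in> I. A t \<in> G e t})"
  proof (rule exists_blocks_many_hits[OF _ _ sz _ _ _ total])
    fix e t assume e: "e \<in> P <+> {1..Suc m}" "t \<in> I"
    have "shifted {s<..n} (link s n m (\<F> i) (j i))" if "i \<in> P" for i
      using shifted_link[OF F(2)[OF PD(1)[OF that]]] j_less[OF that] by auto
    then show "shifted {s<..s + N} (G e t)"
      using e unfolding V G_def S_def by (auto simp: shifted_empty shifted_initial_singletons)
  qed (use finP in \<open>auto simp: I_def\<close>)
  then obtain A where A: "\<And>t. t \<in> I \<Longrightarrow> A t \<in> nsets {s<..n} (sz t)" "disjoint_family_on A I"
    "\<And>e. e \<in> P <+> {1..Suc m} \<Longrightarrow> q e < card {t \<in> I. A t \<in> G e t}"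
    unfolding V by blast
  have AI: "A t \<subseteq> {s<..n}" "finite (A t)" if "t \<in> I" for t using A(1)[OF that] by (auto simp: nsets_def)
  have "\<exists>C. (\<forall>i\<in>P. C i \<in> \<F> i \<and> C i \<subseteq> {1..s} \<union> (\<Union>t\<in>{..<T}. A t)) \<and> disjoint_family_on C P"
  proof (rule exists_rainbow_from_blocks[OF finP j(2) _ q_inj])
    show "j ` P \<subseteq> {1..s}" using j_less by force
    show "A t \<subseteq> {s<..n}" if "t \<in> {..<T}" for t using AI that I(1) by auto
    show "disjoint_family_on A {..<T}" using A(2) I(1) by (auto simp: disjoint_family_on_def)
    fix i assume i: "i \<in> P"
    have "{t \<in> I. A t \<in> G (Inl i) t} = {t \<in> {..<T}. A t \<in> link s n m (\<F> i) (j i)}"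
      by (auto simp: G_def I_def split: if_splits)
    moreover have "s - j i - 1 < card {t \<in> I. A t \<in> G (Inl i) t}"
      using A(3)[OF InlI[OF i]] by (simp add: q_def)
    ultimately have "s - j i - 1 < card {t \<in> {..<T}. A t \<in> link s n m (\<F> i) (j i)}" by (simp only:)
    moreover have "1 \<le> s - j i" using j_less[OF i] by (simp add: Suc_le_eq)
    ultimately show "1 \<le> s - j i \<and> s - j i \<le> card {t \<in> {..<T}. A t \<in> link s n m (\<F> i) (j i)}"
      by linarith
  qed
  then obtain C where C: "\<And>i. i \<in> P \<Longrightarrow> C i \<in> \<F> i"
    "\<And>i. i \<in> P \<Longrightarrow> C i \<subseteq> {1..s} \<union> (\<Union>t\<in>{..<T}. A t)" "disjoint_family_on C P" by blast
  define R where "R = (\<Union>t\<in>{T..<T + \<rho>}. A t)"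
  have R: "R \<subseteq> {s<..n}" "finite R"
  proof -
    have I': "t \<in> I" if "t \<in> {T..<T + \<rho>}" for t using that I(1) by blast
    show "R \<subseteq> {s<..n}" unfolding R_def using AI(1)[OF I'] by blast
    show "finite R" unfolding R_def using AI(2)[OF I'] by (intro finite_UN_I) auto
  qed
  \<comment> \<open>Each of the at most \<open>s\<close> families in \<open>Q\<close> needs
    \<open>l\<close> elements of \<open>R\<close> up to \<open>s + 6 * s * l\<close>, hence the
    demand \<open>s * l\<close>.\<close>
  have R_early: "s * l \<le> card (R \<inter> {s<..s + (6 * s) * l})" if l: "l \<in> {1..Suc m}" for l
  proof -
    define J where "J = {t \<in> {T..<T + \<rho>}. A t \<in> S l}"
    have "{t \<in> I. A t \<in> G (Inr l) t} = J" by (auto simp: G_def I_def J_def split: if_splits)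
    then have "s * l - 1 < card J" using A(3)[OF InrI[OF l]] by (simp add: q_def)
    moreover have "card J \<le> card (R \<inter> {s<..s + (6 * s) * l})"
    proof (rule card_inj_on_le[where f = "\<lambda>t. the_elem (A t)"])
      show "inj_on (\<lambda>t. the_elem (A t)) J"
      proof (rule inj_onI)
        fix t u assume tu: "t \<in> J" "u \<in> J" "the_elem (A t) = the_elem (A u)"
        then obtain y where y: "A t = {y}" "A u = {y}" by (auto simp: J_def S_def)
        show "t = u"
        proof (rule ccontr)
          assume "t \<noteq> u"
          then have "A t \<inter> A u = {}"
            using A(2) tu I(1) by (auto simp: disjoint_family_on_def J_def)
          then show False using y by simp
        qed
      qed
      show "(\<lambda>t. the_elem (A t)) ` J \<subseteq> R \<inter> {s<..s + (6 * s) * l}"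
        by (fastforce simp: J_def S_def R_def)
    qed (use R in auto)
    ultimately show ?thesis by linarith
  qed
  have "card Q \<le> card {1..s}" by (intro card_mono) (auto simp: Q_def)
  then have "\<exists>f. (\<forall>i\<in>Q. f i \<in> nsets (R \<inter> {s<..s + (6 * s) * Suc m}) (Suc m) \<and>
     (\<forall>l\<in>{1..Suc m}. l \<le> card (f i \<inter> {s<..s + (6 * s) * l}))) \<and> disjoint_family_on f Q"
    using R R_early by (intro exists_disjoint_early_sets[where q = s]) (auto simp: Q_def)
  then obtain f where f: "\<And>i. i \<in> Q \<Longrightarrow> f i \<in> nsets (R \<inter> {s<..s + (6 * s) * Suc m}) (Suc m)"
    "\<And>i l. i \<in> Q \<Longrightarrow> l \<in> {1..Suc m} \<Longrightarrow> l \<le> card (f i \<inter> {s<..s + (6 * s) * l})"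
    "disjoint_family_on f Q" by blast
  have fR: "f i \<subseteq> R" if "i \<in> Q" for i using f(1)[OF that] by (auto simp: nsets_def)
  have fF: "f i \<in> \<F> i" if i: "i \<in> Q" for i
  proof -
    have i': "i \<in> {1..s}" "(\<lambda>l. s + (6 * s) * l) ` {1..Suc m} \<in> \<F> i" using i by (auto simp: Q_def P_def)
    have "f i \<in> nsets {s<..n} (Suc m)" using f(1)[OF i] R(1) by (auto simp: nsets_def)
    then show ?thesis
      using f(2)[OF i] c0(2) by (intro mem_of_progression_mem_shifted[OF F(2)[OF i'(1)] i'(2)]) auto
  qed
  have CR: "C i \<inter> R = {}" if i: "i \<in> P" for i
  proof -
    have "{1..s} \<inter> R = {}" using R(1) by fastforce
    moreover have "A t \<inter> A u = {}" if "t \<in> {..<T}" "u \<in> {T..<T + \<rho>}" for t u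
      using A(2) that I unfolding disjoint_family_on_def by auto
    then have "(\<Union>t\<in>{..<T}. A t) \<inter> R = {}" unfolding R_def by blast
    ultimately show ?thesis using C(2)[OF i] by blast
  qed
  define C' where "C' i = (if i \<in> P then C i else f i)" for i
  have "C' i \<in> \<F> i" if "i \<in> {1..s}" for i using that C(1) fF by (auto simp: C'_def Q_def)
  moreover have "disjoint_family_on C' {1..s}"
    unfolding disjoint_family_on_def
  proof (intro ballI impI)
    fix i u assume iu: "i \<in> {1..s}" "u \<in> {1..s}" "i \<noteq> u"
    have inQ: "v \<in> Q" if "v \<in> {1..s}" "v \<notin> P" for v using that by (simp add: Q_def)
    consider "i \<in> P" "u \<in> P" | "i \<in> P" "u \<in> Q" | "i \<in> Q" "u \<in> P" | "i \<in> Q" "u \<in> Q"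
      using inQ iu by blast
    then show "C' i \<inter> C' u = {}"
    proof cases
      case 1 then show ?thesis using C(3) iu by (simp add: C'_def disjoint_family_on_def)
    next
      case 2 then show ?thesis using CR[of i] fR[of u] by (auto simp: C'_def Q_def)
    next
      case 3 then show ?thesis using CR[of u] fR[of i] by (auto simp: C'_def Q_def)
    next
      case 4 then show ?thesis using f(3) iu by (auto simp: C'_def Q_def disjoint_family_on_def)
    qed
  qed
  ultimately show ?thesis by blast
qed

theorem theorem5p2:
  fixes s k n :: nat and \<F> :: "nat \<Rightarrow> nat set set"
  assumes "s \<ge> 1" and "k \<ge> 1"
    and "real n \<ge> 12 * real k * real s * ln ((exp 1)\<^sup>2 * real s)"
    and "\<And>i. i \<in> {1..s} \<Longrightarrow> \<F> i \<subseteq> nsets {1..n} k"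
    and "cross_dependent {1..s} \<F>"
  shows "Min ((\<lambda>i. card (\<F> i)) ` {1..s}) \<le> (n choose k) - ((n - s + 1) choose k)"
proof (rule ccontr)
  assume "\<not> ?thesis"
  then have large: "(n choose k) - ((n - s + 1) choose k) < card (\<F> i)" if "i \<in> {1..s}" for i
    using that by (simp add: not_le)
  have ln: "ln ((exp 1)\<^sup>2 * real s) = 2 + ln (real s)"
    using assms(1) by (simp add: ln_mult ln_realpow)
  show False
  proof (cases "s = 1")
    \<comment> \<open>For \<open>s = 1\<close> the bound is 0, so the only family is nonempty, and a
      choice from one family is trivially disjoint.\<close>
    case True
    then have "\<F> 1 \<noteq> {}" using large[of 1] by auto
    then obtain A where "A \<in> \<F> 1" by blast
    then have "(\<forall>i\<in>{1..s}. A \<in> \<F> i) \<and> disjoint_family_on (\<lambda>_. A) {1..s}"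
      using True by (simp add: disjoint_family_on_def)
    then have "\<exists>C. (\<forall>i\<in>{1..s}. C i \<in> \<F> i) \<and> disjoint_family_on C {1..s}"
      by (intro exI[of _ "\<lambda>_. A"])
    then show False using assms(5) unfolding cross_dependent_def by contradiction
  next
    case False
    then have s: "2 \<le> s" using assms(1) by simp
    have "2 / 3 \<le> ln (2 :: real)" by (rule ln2_ge_two_thirds)
    also have "\<dots> \<le> ln (real s)" using s by simp
    finally have "8 / 3 \<le> ln ((exp 1)\<^sup>2 * real s)" unfolding ln by simp
    then have "12 * real k * real s * (8 / 3) \<le> 12 * real k * real s * ln ((exp 1)\<^sup>2 * real s)"
      by (intro mult_left_mono) auto
    also have "\<dots> \<le> real n" by (rule assms(3))
    also have "12 * real k * real s * (8 / 3) = real (32 * (s * k))" by simp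
    finally have n: "32 * (s * k) \<le> n" by (simp only: of_nat_le_iff)
    obtain m where k: "k = Suc m" using assms(2) by (cases k) auto
    obtain \<H> where "\<forall>i\<in>{1..s}. \<H> i \<subseteq> nsets {1..n} (Suc m) \<and> card (\<H> i) = card (\<F> i) \<and> shifted {1..n} (\<H> i)"
      and cross: "cross_dependent {1..s} \<H>"
      using exists_shifted_families[OF finite_atLeastAtMost assms(4,5)] unfolding k by blast
    then have H: "\<And>i. i \<in> {1..s} \<Longrightarrow> \<H> i \<subseteq> nsets {1..n} (Suc m)"
      "\<And>i. i \<in> {1..s} \<Longrightarrow> shifted {1..n} (\<H> i)"
      "\<And>i. i \<in> {1..s} \<Longrightarrow> card (\<H> i) = card (\<F> i)" by blast+
    have large': "(n choose Suc m) - ((n - s + 1) choose Suc m) < card (\<H> i)" if "i \<in> {1..s}" for i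
      using large[OF that] H(3)[OF that] by (simp only: k)
    have "\<exists>C. (\<forall>i\<in>{1..s}. C i \<in> \<H> i) \<and> disjoint_family_on C {1..s}"
    proof (cases "\<exists>i\<in>{1..s}. (\<lambda>l. s + (6 * s) * l) ` {1..Suc m} \<in> \<H> i")
      case True
      then show ?thesis
        using rainbow_with_progression[where \<F> = \<H>, OF s n[unfolded k] H(1,2) large'] by blast
    next
      case False
      then show ?thesis
        using rainbow_without_progressions[where \<F> = \<H>, OF s n[unfolded k] H(1,2) large'] by blast
    qed
    then show False using cross unfolding cross_dependent_def by contradiction
  qed
qed

end
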